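(* Let $M$ be a compact metrizable space, let $\Gamma$ be a group with a finite generating set $S$, and let $\rho_0:\Gamma\to\mathrm{Homeo}(M)$ be an action. Let $\mathcal S,\mathcal S'$ be proto-coders adapted to $\rho_0$, with $\mathcal S$ given by index set $Z(\mathcal S)$ and coverings $\{U(z)\},\{W(z)\}$, and suppose that all of the following hold: (P1) Both $\mathcal S$ and $\mathcal S'$ are $\rho_0$-stable. (P2) The point coders $\mathcal G=\mathcal G(\mathcal S,\rho_0)$ and $\mathcal G'=\mathcal G(\mathcal S',\rho_0)$ generated by $\mathcal S,\mathcal S'$ and $\rho_0$ are both $\rho_0$-contracting. (P3) For every pair of distinct points $p,p'\in M$ there exists $\gamma\in\Gamma$ such that for any $z,z'\in Z(\mathcal S)$ satisfying $\rho_0(\gamma)p\in U(z)$ and $\rho_0(\gamma)p'\in U(z')$, we have $W(z)\cap W(z')=\emptyset$. (P4) There is a finite subset $F\subset\Gamma$ satisfying the following: whenever $\mathbf c_1$ and $\mathbf c_2$ are two $(\mathcal G,\rho_0)$-codings of the same point $p\in M$ whose initial points both lie in $S\cup\{\mathrm{id}\}$, there is a $(\mathcal G',\rho_0)$-coding of $p$ starting at $\mathrm{id}$ which is $F$-close to both $\mathbf c_1$ and $\mathbf c_2$. Then $\rho_0$ is topologically stable: there is a neighborhood $\mathcal U$ of $\rho_0$ in $\mathrm{Hom}(\Gamma,\mathrm{Homeo}(M))$ such that for every $\rho\in\mathcal U$ there is a continuous surjective map $\phi:M\to M$ with $\phi\circ\rho(\gamma)=\rho_0(\gamma)\circ\phi$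 for all $\gamma\in\Gamma$.
   Context: $\mathrm{Homeo}(M)$ has the compact-open topology and $\mathrm{Hom}(\Gamma,\mathrm{Homeo}(M))$ the topology of pointwise convergence on $\Gamma$. Let $\rho:\Gamma\to\mathrm{Homeo}(M)$ be an action. A finitary $\rho$-coder (point coder) is a finite directed graph $\mathcal G=(\mathcal V,\mathcal E)$ with vertex labels $W(v)$ ($v\in\mathcal V$), which are open subsets of $M$, and edge labels $\alpha(e)\in\Gamma$ ($e\in\mathcal E$), such that whenever there is an edge from $z_1$ to $z_2$ labeled by $\alpha$, one has $\overline{\rho(\alpha)W(z_2)}\subset W(z_1)$. A $\mathcal G$-coding is a pair $\mathbf c=(g_0,(e_n)_{n=1}^\infty)$ with $g_0\in\Gamma$ and $(e_n)$ an infinite directed edge path in $\mathcal G$. Its path sequence is $g_k=g_0\alpha(e_1)\cdots\alpha(e_k)$, $k\ge0$; its terminal vertex sequence is $(z_n)_{n\ge1}$, where $z_n$ is the terminal vertex of $e_n$; $g_0$ is its initial point, and $\mathbf c$ starts at $g_0$. $\mathbf c$ is a $(\mathcal G,\rho)$-coding of $p\in M$ if $p\in\bigcap_{n\ge1}\rho(g_n)W(z_n)$. $\mathbf c$ is $\rho$-contracting if this intersection is a singleton; $\mathcal G$ is $\rho$-contracting if every $\mathcal G$-coding is. For a finite $F\subset\Gamma$, codings with path sequences $(g_k)$ and $(h_j)$ (possibly of different point coders) are $F$-close if there are arbitrarily large indices $m,n$ (for each $N$, a pair with both $m,n>N$) such that $g_n^{-1}h_m\in F$. A proto-coder $\mathcal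 S$ consists of a finite index set $Z=Z(\mathcal S)$, two open coverings $\{W(z)\}_{z\in Z}$, $\{U(z)\}_{z\in Z}$ of $M$ with $U(z)\subset W(z)$ for each $z$, and an element $\alpha(z)\in\Gamma$ for each $z\in Z$. It is adapted to $\rho$ if for all $y,z\in Z$ with $\rho(\alpha(z))^{-1}U(z)\cap U(y)\neq\emptyset$ we have $\overline{W(y)}\subset\rho(\alpha(z))^{-1}W(z)$. An adapted proto-coder is $\rho$-stable if for all $y,z\in Z$: $\rho(\alpha(z))^{-1}U(z)\cap U(y)=\emptyset\iff\rho(\alpha(z))^{-1}\overline{U(z)}\cap\overline{U(y)}=\emptyset$. For $\mathcal S$ adapted to $\rho$, the point coder $\mathcal G(\mathcal S,\rho)$ generated by $\mathcal S$ and $\rho$ has vertex set $Z$, vertex labels $W(z)$, and an edge from $z$ to $y$, labeled by $\alpha(z)$, if and only if $\rho(\alpha(z))^{-1}U(z)\cap U(y)\ne\emptyset$. *)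

theory Defs
  imports "HOL-Analysis.Analysis" "HOL-Algebra.Bij" "HOL-Algebra.Generated_Groups"
    "Graph_Theory.Digraph"
begin

section \<open>Homeomorphism groups and spaces of actions\<close>

text \<open>As in \<^const>\<open>BijGroup\<close>, homeomorphisms are taken extensional, so that two of them are equal
  as soon as they agree on the space.\<close>

definition homeo_group :: "'m topology \<Rightarrow> ('m \<Rightarrow> 'm) monoid" where
  "homeo_group M =
    (BijGroup (topspace M)) \<lparr> carrier := {f \<in> Bij (topspace M). homeomorphic_map M M f} \<rparr>"

lemma carrier_homeo_group:
  "f \<in> carrier (homeo_group M) \<longleftrightarrow> f \<in> extensional (topspace M) \<and> homeomorphic_map M M f"
  by (auto simp: homeo_group_def Bij_def bij_betw_def dest: homeomorphic_imp_surjective_map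
      homeomorphic_imp_injective_map)

lemma group_homeo_group: "group (homeo_group M)"
proof -
  interpret B: group "BijGroup (topspace M)" by (rule group_BijGroup)
  let ?H = "{f \<in> Bij (topspace M). homeomorphic_map M M f}"
  have one: "\<one>\<^bsub>BijGroup (topspace M)\<^esub> \<in> ?H"
    using homeomorphic_map_eq[of M M id "\<lambda>x\<in>topspace M. x"] by (auto simp: BijGroup_def id_Bij)
  have "subgroup ?H (BijGroup (topspace M))"
  proof (rule B.subgroupI)
    show "?H \<subseteq> carrier (BijGroup (topspace M))" by (auto simp: BijGroup_def)
    show "?H \<noteq> {}" using one by blast
  next
    fix f assume f: "f \<in> ?H"
    then obtain g where g: "homeomorphic_maps M M f g"
      by (auto simp: homeomorphic_map_maps)
    have "inv\<^bsub>BijGroup (topspace M)\<^esub> f = (\<lambda>x\<in>topspace M. inv_into (topspace M) f x)"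
      using f by (intro B.inv_equality)
        (auto simp: BijGroup_def restrict_inv_into_Bij Bij_compose_restrict_eq)
    moreover have "homeomorphic_map M M (\<lambda>x\<in>topspace M. inv_into (topspace M) f x)"
    proof (rule homeomorphic_map_eq)
      show "homeomorphic_map M M g"
        using g homeomorphic_maps_map by blast
      fix x assume x: "x \<in> topspace M"
      then have "g x \<in> topspace M" "f (g x) = x"
        using g by (auto simp: homeomorphic_maps_def continuous_map_def)
      moreover have "inj_on f (topspace M)"
        using f homeomorphic_imp_injective_map by blast
      ultimately have "inv_into (topspace M) f x = g x"
        by (metis inv_into_f_f)
      then show "g x = (\<lambda>x\<in>topspace M. inv_into (topspace M) f x) x"
        using x by simp
    qed
    ultimately show "inv\<^bsub>BijGroup (topspace M)\<^esub> f \<in> ?H"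
      using f by (auto simp: restrict_inv_into_Bij)
  next
    fix f g assume fg: "f \<in> ?H" "g \<in> ?H"
    have "homeomorphic_map M M (compose (topspace M) f g)"
      by (rule homeomorphic_map_eq[of M M "f \<circ> g"])
        (use fg homeomorphic_map_compose in \<open>auto simp: compose_def\<close>)
    then show "f \<otimes>\<^bsub>BijGroup (topspace M)\<^esub> g \<in> ?H"
      using fg by (auto simp: BijGroup_def compose_Bij)
  qed
  then show ?thesis
    unfolding homeo_group_def by (rule B.subgroup_imp_group)
qed

definition compact_open_topology :: "'m topology \<Rightarrow> ('m \<Rightarrow> 'm) topology" where
  "compact_open_topology M =
    topology_generated_by
      {{f \<in> carrier (homeo_group M). f ` K \<subseteq> V} | K V. compactin M K \<and> openin M V}"

lemma topspace_compact_open_topology: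
  "topspace (compact_open_topology M) = carrier (homeo_group M)"
proof -
  have "carrier (homeo_group M)
      \<in> {{f \<in> carrier (homeo_group M). f ` K \<subseteq> V} | K V. compactin M K \<and> openin M V}"
    by (rule CollectI, intro exI[of _ "{}"]) simp
  then show ?thesis
    unfolding compact_open_topology_def topology_generated_by_topspace by blast
qed

text \<open>Actions are normalised outside the carrier of the group, so that they are points of the
  product space of functions on the carrier.\<close>

definition actions :: "('g, 'b) monoid_scheme \<Rightarrow> 'm topology \<Rightarrow> ('g \<Rightarrow> 'm \<Rightarrow> 'm) set" where
  "actions \<Gamma> M = hom \<Gamma> (homeo_group M) \<inter> extensional (carrier \<Gamma>)"

definition action_topology ::
    "('g, 'b) monoid_scheme \<Rightarrow> 'm topology \<Rightarrow> ('g \<Rightarrow> 'm \<Rightarrow> 'm) topology" where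
  "action_topology \<Gamma> M =
    subtopology (product_topology (\<lambda>_. compact_open_topology M) (carrier \<Gamma>)) (actions \<Gamma> M)"

lemma topspace_action_topology: "topspace (action_topology \<Gamma> M) = actions \<Gamma> M"
  by (auto simp: action_topology_def actions_def topspace_compact_open_topology hom_def
      PiE_def Pi_def)

definition topologically_stable ::
    "('g, 'b) monoid_scheme \<Rightarrow> 'm topology \<Rightarrow> ('g \<Rightarrow> 'm \<Rightarrow> 'm) \<Rightarrow> bool" where
  "topologically_stable \<Gamma> M \<rho>\<^sub>0 \<longleftrightarrow>
    (\<exists>\<U>. openin (action_topology \<Gamma> M) \<U> \<and> \<rho>\<^sub>0 \<in> \<U> \<and>
      (\<forall>\<rho>\<in>\<U>. \<exists>\<phi>. continuous_map M M \<phi> \<and> \<phi> ` topspace M = topspace M \<and>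
        (\<forall>\<gamma>\<in>carrier \<Gamma>. \<forall>x\<in>topspace M. \<phi> (\<rho> \<gamma> x) = \<rho>\<^sub>0 \<gamma> (\<phi> x))))"


section \<open>Point coders and codings\<close>

record ('v, 'e, 'g, 'm) point_coder = "('v, 'e) pre_digraph" +
  vlabel :: "'v \<Rightarrow> 'm set"
  elabel :: "'e \<Rightarrow> 'g"

definition is_point_coder ::
    "('g, 'b) monoid_scheme \<Rightarrow> 'm topology \<Rightarrow> ('g \<Rightarrow> 'm \<Rightarrow> 'm) \<Rightarrow>
     ('v, 'e, 'g, 'm) point_coder \<Rightarrow> bool" where
  "is_point_coder \<Gamma> M \<rho> \<G> \<longleftrightarrow>
    fin_digraph (pre_digraph.truncate \<G>) \<and>
    (\<forall>v\<in>verts \<G>. openin M (vlabel \<G> v)) \<and>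
    (\<forall>e\<in>arcs \<G>. elabel \<G> e \<in> carrier \<Gamma> \<and>
      M closure_of (\<rho> (elabel \<G> e) ` vlabel \<G> (head \<G> e)) \<subseteq> vlabel \<G> (tail \<G> e))"

text \<open>In a coding \<open>(g\<^sub>0, e)\<close> the edge path is indexed from 0: the edge \<open>e\<^sub>n\<close> of the informal
  definition (\<open>n \<ge> 1\<close>) is \<open>e (n - 1)\<close>.  Path sequences are indexed from 0 in both.\<close>

definition coding ::
    "('g, 'b) monoid_scheme \<Rightarrow> ('v, 'e, 'g, 'm) point_coder \<Rightarrow> 'g \<times> (nat \<Rightarrow> 'e) \<Rightarrow> bool" where
  "coding \<Gamma> \<G> c \<longleftrightarrow>
    fst c \<in> carrier \<Gamma> \<and>
    (\<forall>n. snd c n \<in> arcs \<G> \<and> head \<G> (snd c n) = tail \<G> (snd c (Suc n)))"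

primrec path_seq ::
    "('g, 'b) monoid_scheme \<Rightarrow> ('v, 'e, 'g, 'm) point_coder \<Rightarrow> 'g \<times> (nat \<Rightarrow> 'e) \<Rightarrow> nat \<Rightarrow> 'g" where
  "path_seq \<Gamma> \<G> c 0 = fst c"
| "path_seq \<Gamma> \<G> c (Suc k) = path_seq \<Gamma> \<G> c k \<otimes>\<^bsub>\<Gamma>\<^esub> elabel \<G> (snd c k)"

text \<open>The vertex \<open>terminal_vertex \<G> c n\<close> is meaningful for \<open>n \<ge> 1\<close> only.\<close>

definition terminal_vertex ::
    "('v, 'e, 'g, 'm) point_coder \<Rightarrow> 'g \<times> (nat \<Rightarrow> 'e) \<Rightarrow> nat \<Rightarrow> 'v" where
  "terminal_vertex \<G> c n = head \<G> (snd c (n - 1))"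

definition coded_set ::
    "('g, 'b) monoid_scheme \<Rightarrow> ('v, 'e, 'g, 'm) point_coder \<Rightarrow> ('g \<Rightarrow> 'm \<Rightarrow> 'm) \<Rightarrow>
     'g \<times> (nat \<Rightarrow> 'e) \<Rightarrow> 'm set" where
  "coded_set \<Gamma> \<G> \<rho> c =
    (\<Inter>n\<in>{1..}. \<rho> (path_seq \<Gamma> \<G> c n) ` vlabel \<G> (terminal_vertex \<G> c n))"

definition coding_of ::
    "('g, 'b) monoid_scheme \<Rightarrow> ('v, 'e, 'g, 'm) point_coder \<Rightarrow> ('g \<Rightarrow> 'm \<Rightarrow> 'm) \<Rightarrow>
     'g \<times> (nat \<Rightarrow> 'e) \<Rightarrow> 'm \<Rightarrow> bool" where
  "coding_of \<Gamma> \<G> \<rho> c p \<longleftrightarrow> coding \<Gamma> \<G> c \<and> p \<in> coded_set \<Gamma> \<G> \<rho> c"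

definition contracting ::
    "('g, 'b) monoid_scheme \<Rightarrow> ('v, 'e, 'g, 'm) point_coder \<Rightarrow> ('g \<Rightarrow> 'm \<Rightarrow> 'm) \<Rightarrow> bool" where
  "contracting \<Gamma> \<G> \<rho> \<longleftrightarrow> (\<forall>c. coding \<Gamma> \<G> c \<longrightarrow> (\<exists>p. coded_set \<Gamma> \<G> \<rho> c = {p}))"

definition F_close ::
    "('g, 'b) monoid_scheme \<Rightarrow> 'g set \<Rightarrow> (nat \<Rightarrow> 'g) \<Rightarrow> (nat \<Rightarrow> 'g) \<Rightarrow> bool" where
  "F_close \<Gamma> F g h \<longleftrightarrow> (\<forall>N. \<exists>n>N. \<exists>m>N. inv\<^bsub>\<Gamma>\<^esub> (g n) \<otimes>\<^bsub>\<Gamma>\<^esub> h m \<in> F)"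


section \<open>Proto-coders\<close>

record ('z, 'g, 'm) proto_coder =
  index :: "'z set"
  Wset :: "'z \<Rightarrow> 'm set"
  Uset :: "'z \<Rightarrow> 'm set"
  label :: "'z \<Rightarrow> 'g"

definition is_proto_coder ::
    "('g, 'b) monoid_scheme \<Rightarrow> 'm topology \<Rightarrow> ('z, 'g, 'm) proto_coder \<Rightarrow> bool" where
  "is_proto_coder \<Gamma> M \<S> \<longleftrightarrow>
    finite (index \<S>) \<and>
    (\<forall>z\<in>index \<S>. openin M (Wset \<S> z) \<and> openin M (Uset \<S> z) \<and>
      Uset \<S> z \<subseteq> Wset \<S> z \<and> label \<S> z \<in> carrier \<Gamma>) \<and>
    (\<Union>z\<in>index \<S>. Wset \<S> z) = topspace M \<and>
    (\<Union>z\<in>index \<S>. Uset \<S> z) = topspace M"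

definition preimage :: "'m topology \<Rightarrow> ('m \<Rightarrow> 'm) \<Rightarrow> 'm set \<Rightarrow> 'm set" where
  "preimage M f A = {x \<in> topspace M. f x \<in> A}"

definition adapted ::
    "'m topology \<Rightarrow> ('g \<Rightarrow> 'm \<Rightarrow> 'm) \<Rightarrow> ('z, 'g, 'm) proto_coder \<Rightarrow> bool" where
  "adapted M \<rho> \<S> \<longleftrightarrow>
    (\<forall>y\<in>index \<S>. \<forall>z\<in>index \<S>.
      preimage M (\<rho> (label \<S> z)) (Uset \<S> z) \<inter> Uset \<S> y \<noteq> {} \<longrightarrow>
      M closure_of (Wset \<S> y) \<subseteq> preimage M (\<rho> (label \<S> z)) (Wset \<S> z))"

definition stable ::
    "'m topology \<Rightarrow> ('g \<Rightarrow> 'm \<Rightarrow> 'm) \<Rightarrow> ('z, 'g, 'm) proto_coder \<Rightarrow> bool" where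
  "stable M \<rho> \<S> \<longleftrightarrow>
    (\<forall>y\<in>index \<S>. \<forall>z\<in>index \<S>.
      preimage M (\<rho> (label \<S> z)) (Uset \<S> z) \<inter> Uset \<S> y = {} \<longleftrightarrow>
      preimage M (\<rho> (label \<S> z)) (M closure_of (Uset \<S> z)) \<inter> M closure_of (Uset \<S> y) = {})"

text \<open>There is at most one edge from \<open>z\<close> to \<open>y\<close>, represented by the pair \<open>(z, y)\<close>.\<close>

definition generated_coder ::
    "'m topology \<Rightarrow> ('z, 'g, 'm) proto_coder \<Rightarrow> ('g \<Rightarrow> 'm \<Rightarrow> 'm) \<Rightarrow>
     ('z, 'z \<times> 'z, 'g, 'm) point_coder" where
  "generated_coder M \<S> \<rho> =
    \<lparr> verts = index \<S>,
      arcs = {(z, y). z \<in> index \<S> \<and> y \<in> index \<S> \<and>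
        preimage M (\<rho> (label \<S> z)) (Uset \<S> z) \<inter> Uset \<S> y \<noteq> {}},
      tail = fst,
      head = snd,
      vlabel = Wset \<S>,
      elabel = (\<lambda>(z, y). label \<S> z) \<rparr>"

lemma is_point_coder_generated_coder:
  assumes "\<rho> \<in> actions \<Gamma> M" "is_proto_coder \<Gamma> M \<S>" "adapted M \<rho> \<S>"
  shows "is_point_coder \<Gamma> M \<rho> (generated_coder M \<S> \<rho>)"
proof -
  let ?G = "generated_coder M \<S> \<rho>"
  have fin: "finite (index \<S>)" using assms(2) by (simp add: is_proto_coder_def)
  have "finite (arcs ?G)"
    by (rule finite_subset[of _ "index \<S> \<times> index \<S>"]) (auto simp: generated_coder_def fin)
  then have "fin_digraph (pre_digraph.truncate ?G)"
    by unfold_locales (auto simp: generated_coder_def pre_digraph.truncate_def fin)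
  moreover have "M closure_of (\<rho> (label \<S> z) ` Wset \<S> y) \<subseteq> Wset \<S> z"
    if z: "z \<in> index \<S>" and y: "y \<in> index \<S>"
      and e: "preimage M (\<rho> (label \<S> z)) (Uset \<S> z) \<inter> Uset \<S> y \<noteq> {}" for z y
  proof -
    have "label \<S> z \<in> carrier \<Gamma>" "Wset \<S> y \<subseteq> topspace M"
      using assms(2) y z openin_subset by (fastforce simp: is_proto_coder_def)+
    moreover from this have "homeomorphic_map M M (\<rho> (label \<S> z))"
      using assms(1) by (auto simp: actions_def hom_def Pi_def carrier_homeo_group)
    ultimately have "M closure_of (\<rho> (label \<S> z) ` Wset \<S> y)
        = \<rho> (label \<S> z) ` (M closure_of Wset \<S> y)"
      using homeomorphic_map_closure_of by blast
    also have "\<dots> \<subseteq> Wset \<S> z"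
      using assms(3) y z e by (fastforce simp: adapted_def preimage_def)
    finally show ?thesis .
  qed
  ultimately show ?thesis
    using assms(2) by (auto simp: is_point_coder_def is_proto_coder_def generated_coder_def)
qed

end

theory Submission
  imports Defs
begin

text \<open>For \<open>\<rho>\<close> near \<open>\<rho>\<^sub>0\<close> the coders keep their edges and labels, so a coding \<open>c\<close> of a point \<open>q\<close>
  for \<open>\<rho>\<^sub>0\<close> also has a nonempty coded set \<open>K c\<close> for \<open>\<rho>\<close>. Contraction is uniform over all codings by
  compactness of the path space; hence \<open>F\<close>-closeness of two codings of \<open>q\<close> forces interleaved
  inclusions of their cells that follow from finitely many open conditions on the action, and these
  survive for \<open>\<rho>\<close>. By (P4), through the intermediate coding of the second coder, \<open>K c\<close> depends on \<open>q\<close>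
  only, as long as \<open>c\<close> starts in \<open>S \<union> {id}\<close>. Calling it \<open>K q\<close>, starting at a generator gives
  equivariance, greedy codings show that the sets \<open>K q\<close> cover the space, and (P3) makes them disjoint.
  The semiconjugacy sends all of \<open>K q\<close> to \<open>q\<close>.\<close>


section \<open>Actions by homeomorphisms\<close>

locale homeo_action = group \<Gamma> for \<Gamma> :: "('g, 'b) monoid_scheme" (structure) +
  fixes M :: "'m topology" and \<rho> :: "'g \<Rightarrow> 'm \<Rightarrow> 'm"
  assumes action: "\<rho> \<in> actions \<Gamma> M"
begin

lemma homeomorphic_action: "\<gamma> \<in> carrier \<Gamma> \<Longrightarrow> homeomorphic_map M M (\<rho> \<gamma>)"
  using action by (auto simp: actions_def hom_def Pi_def carrier_homeo_group)

lemma action_closed: "\<gamma> \<in> carrier \<Gamma> \<Longrightarrow> x \<in> topspace M \<Longrightarrow> \<rho> \<gamma> x \<in> topspace M"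
  using homeomorphic_action homeomorphic_imp_surjective_map by blast

lemma action_mult:
  assumes "\<gamma> \<in> carrier \<Gamma>" "\<delta> \<in> carrier \<Gamma>" "x \<in> topspace M"
  shows "\<rho> (\<gamma> \<otimes> \<delta>) x = \<rho> \<gamma> (\<rho> \<delta> x)"
proof -
  have "\<rho> \<gamma> \<in> carrier (homeo_group M)" "\<rho> \<delta> \<in> carrier (homeo_group M)"
    and "\<rho> (\<gamma> \<otimes> \<delta>) = \<rho> \<gamma> \<otimes>\<^bsub>homeo_group M\<^esub> \<rho> \<delta>"
    using action assms by (auto simp: actions_def hom_def)
  then show ?thesis
    using assms(3) by (simp add: homeo_group_def BijGroup_def compose_def)
qed

text \<open>Membership in \<open>hom\<close> gives closure and multiplicativity only, so the
  identity law is derived: \<open>\<rho> \<one>\<close> is idempotent and injective.\<close>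

lemma action_one:
  assumes x: "x \<in> topspace M"
  shows "\<rho> \<one> x = x"
proof -
  have "\<rho> \<one> (\<rho> \<one> x) = \<rho> \<one> x"
    using action_mult[OF one_closed one_closed x] by simp
  then show ?thesis
    using inj_onD[OF homeomorphic_imp_injective_map[OF homeomorphic_action[OF one_closed]]]
      action_closed[OF one_closed x] x by blast
qed

lemma action_inv:
  assumes "\<gamma> \<in> carrier \<Gamma>" "x \<in> topspace M"
  shows "\<rho> (inv \<gamma>) (\<rho> \<gamma> x) = x" "\<rho> \<gamma> (\<rho> (inv \<gamma>) x) = x"
  using action_mult[OF inv_closed[OF assms(1)] assms]
    action_mult[OF assms(1) inv_closed[OF assms(1)] assms(2)]
    action_one[OF assms(2)] l_inv[OF assms(1)] r_inv[OF assms(1)] by simp_all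

lemma image_action_mult:
  assumes "\<gamma> \<in> carrier \<Gamma>" "\<delta> \<in> carrier \<Gamma>" "A \<subseteq> topspace M"
  shows "\<rho> (\<gamma> \<otimes> \<delta>) ` A = \<rho> \<gamma> ` \<rho> \<delta> ` A"
  unfolding image_image using assms action_mult by (intro image_cong) blast+

lemma mem_image_action_iff:
  assumes "\<gamma> \<in> carrier \<Gamma>" "A \<subseteq> topspace M" "x \<in> topspace M"
  shows "x \<in> \<rho> \<gamma> ` A \<longleftrightarrow> \<rho> (inv \<gamma>) x \<in> A"
proof
  assume "\<rho> (inv \<gamma>) x \<in> A"
  then show "x \<in> \<rho> \<gamma> ` A"
    using action_inv(2)[OF assms(1,3)] by (rule rev_image_eqI[OF _ sym])
next
  assume "x \<in> \<rho> \<gamma> ` A"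
  then obtain a where "a \<in> A" "x = \<rho> \<gamma> a" by blast
  then show "\<rho> (inv \<gamma>) x \<in> A"
    using action_inv(1)[OF assms(1), of a] assms(2) by auto
qed

lemma image_action_subset: "\<gamma> \<in> carrier \<Gamma> \<Longrightarrow> A \<subseteq> topspace M \<Longrightarrow> \<rho> \<gamma> ` A \<subseteq> topspace M"
  using action_closed by blast

lemma openin_image_action: "\<gamma> \<in> carrier \<Gamma> \<Longrightarrow> openin M A \<Longrightarrow> openin M (\<rho> \<gamma> ` A)"
  using homeomorphic_map_openness[OF homeomorphic_action openin_subset] by simp

lemma closure_of_image_action:
  "\<gamma> \<in> carrier \<Gamma> \<Longrightarrow> A \<subseteq> topspace M \<Longrightarrow> M closure_of (\<rho> \<gamma> ` A) = \<rho> \<gamma> ` (M closure_of A)"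
  using homeomorphic_action homeomorphic_map_closure_of by blast

lemma image_inter_action:
  assumes "\<gamma> \<in> carrier \<Gamma>" "\<And>i. A i \<subseteq> topspace M"
  shows "(\<Inter>i::nat. \<rho> \<gamma> ` A i) = \<rho> \<gamma> ` (\<Inter>i. A i)"
  using image_INT[of "\<rho> \<gamma>" "topspace M" UNIV A 0] assms
    homeomorphic_imp_injective_map[OF homeomorphic_action[of \<gamma>]] by auto

text \<open>The condition is the preimage of a subbasic set of the compact-open topology under the
  continuous evaluation at \<open>\<gamma>\<close>. The persistence statements below are reduced to
  finitely many conditions of this kind.\<close>

lemma eventually_image_subset:
  assumes "\<gamma> \<in> carrier \<Gamma>" "compactin M K" "openin M V" "\<rho> \<gamma> ` K \<subseteq> V"
  shows "\<forall>\<^sub>F \<sigma> in nhdsin (action_topology \<Gamma> M) \<rho>. \<sigma> \<gamma> ` K \<subseteq> V"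
proof -
  let ?B = "{f \<in> carrier (homeo_group M). f ` K \<subseteq> V}"
  let ?O = "{\<sigma> \<in> topspace (action_topology \<Gamma> M). \<sigma> \<gamma> \<in> ?B}"
  have "continuous_map (action_topology \<Gamma> M) (compact_open_topology M) (\<lambda>\<sigma>. \<sigma> \<gamma>)"
    unfolding action_topology_def
    using assms(1) by (intro continuous_map_from_subtopology continuous_map_product_projection)
  moreover have "openin (compact_open_topology M) ?B"
    unfolding compact_open_topology_def
    using assms(2,3) by (intro topology_generated_by_Basis) blast
  ultimately have "openin (action_topology \<Gamma> M) ?O"
    by (rule openin_continuous_map_preimage)
  moreover have "\<rho> \<in> ?O"
    using assms action by (auto simp: topspace_action_topology actions_def hom_def)
  ultimately show ?thesis
    unfolding eventually_nhdsin by blast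
qed

lemma eventually_homeo_action: "\<forall>\<^sub>F \<sigma> in nhdsin (action_topology \<Gamma> M) \<rho>. homeo_action \<Gamma> M \<sigma>"
  unfolding eventually_nhdsin homeo_action_def homeo_action_axioms_def
  using is_group openin_topspace[of "action_topology \<Gamma> M"] by (auto simp: topspace_action_topology)

end


section \<open>Codings and their cells\<close>

text \<open>Labelling by the tail of the next edge, rather than by the terminal vertex, makes the cells nested
  from index 0 on; for a coding the two agree at every \<open>n \<ge> 1\<close>.\<close>

definition cell ::
    "('g, 'b) monoid_scheme \<Rightarrow> ('v, 'e, 'g, 'm) point_coder \<Rightarrow> ('g \<Rightarrow> 'm \<Rightarrow> 'm) \<Rightarrow>
     'g \<times> (nat \<Rightarrow> 'e) \<Rightarrow> nat \<Rightarrow> 'm set" where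
  "cell \<Gamma> \<G> \<rho> c n = \<rho> (path_seq \<Gamma> \<G> c n) ` vlabel \<G> (tail \<G> (snd c n))"

lemma path_seq_cong:
  assumes "fst c = fst d" "\<And>i. i < n \<Longrightarrow> snd c i = snd d i"
  shows "path_seq \<Gamma> \<G> c n = path_seq \<Gamma> \<G> d n"
  using assms by (induction n) auto

lemma cell_cong:
  assumes "fst c = fst d" "\<And>i. i \<le> n \<Longrightarrow> snd c i = snd d i"
  shows "cell \<Gamma> \<G> \<rho> c n = cell \<Gamma> \<G> \<rho> d n"
  using assms path_seq_cong[of c d n \<Gamma> \<G>] by (simp add: cell_def)

text \<open>The coder is a parameter separate from the action, so that one and the same labelled
  graph can be interpreted for \<open>\<rho>\<^sub>0\<close> and for its perturbations.\<close>

locale coder_action = homeo_action \<Gamma> M \<rho>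
  for \<Gamma> :: "('g, 'b) monoid_scheme" (structure) and M :: "'m topology" and \<rho> +
  fixes \<G> :: "('v, 'e, 'g, 'm) point_coder"
  assumes point_coder: "is_point_coder \<Gamma> M \<rho> \<G>"
    and compact: "compact_space M"
begin

lemma finite_verts: "finite (verts \<G>)"
  and finite_arcs: "finite (arcs \<G>)"
  and tail_in_verts: "e \<in> arcs \<G> \<Longrightarrow> tail \<G> e \<in> verts \<G>"
  and head_in_verts: "e \<in> arcs \<G> \<Longrightarrow> head \<G> e \<in> verts \<G>"
proof -
  interpret fin_digraph "pre_digraph.truncate \<G>"
    using point_coder by (simp add: is_point_coder_def)
  show "finite (verts \<G>)" "finite (arcs \<G>)"
    "e \<in> arcs \<G> \<Longrightarrow> tail \<G> e \<in> verts \<G>" "e \<in> arcs \<G> \<Longrightarrow> head \<G> e \<in> verts \<G>"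
    using finite_verts finite_arcs tail_in_verts head_in_verts
    by (auto simp: pre_digraph.truncate_def)
qed

lemma elabel_closed: "e \<in> arcs \<G> \<Longrightarrow> elabel \<G> e \<in> carrier \<Gamma>"
  using point_coder by (simp add: is_point_coder_def)

lemma openin_vlabel: "v \<in> verts \<G> \<Longrightarrow> openin M (vlabel \<G> v)"
  using point_coder by (simp add: is_point_coder_def)

lemma vlabel_subset: "v \<in> verts \<G> \<Longrightarrow> vlabel \<G> v \<subseteq> topspace M"
  using openin_vlabel openin_subset by blast

lemma closure_edge_subset:
  "e \<in> arcs \<G> \<Longrightarrow> M closure_of (\<rho> (elabel \<G> e) ` vlabel \<G> (head \<G> e)) \<subseteq> vlabel \<G> (tail \<G> e)"
  using point_coder by (simp add: is_point_coder_def)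

lemma compactin_closure: "compactin M (M closure_of A)"
  by (rule closedin_compact_space[OF compact closedin_closure_of])

lemma path_seq_closed:
  assumes "fst c \<in> carrier \<Gamma>" "\<And>i. snd c i \<in> arcs \<G>"
  shows "path_seq \<Gamma> \<G> c n \<in> carrier \<Gamma>"
  by (induction n) (simp_all add: assms elabel_closed)

text \<open>This is the edge condition of the coder for edge \<open>n\<close>, moved by the
  homeomorphism of \<open>path_seq \<Gamma> \<G> c n\<close>, which commutes with closures.
  Composability is assumed at \<open>n\<close> alone so that the lemma also applies to paths that
  are composable only up to some stage.\<close>

lemma closure_cell_Suc_subset:
  assumes "fst c \<in> carrier \<Gamma>" "\<And>i. snd c i \<in> arcs \<G>" "head \<G> (snd c n) = tail \<G> (snd c (Suc n))"
  shows "M closure_of (cell \<Gamma> \<G> \<rho> c (Suc n)) \<subseteq> cell \<Gamma> \<G> \<rho> c n"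
proof -
  let ?e = "snd c n" and ?g = "path_seq \<Gamma> \<G> c n"
  have e: "?e \<in> arcs \<G>" and g: "?g \<in> carrier \<Gamma>"
    using assms path_seq_closed by auto
  have W: "vlabel \<G> (head \<G> ?e) \<subseteq> topspace M"
    using e head_in_verts vlabel_subset by blast
  have "cell \<Gamma> \<G> \<rho> c (Suc n) = \<rho> ?g ` \<rho> (elabel \<G> ?e) ` vlabel \<G> (head \<G> ?e)"
    using image_action_mult[OF g elabel_closed[OF e] W] assms(3) by (simp add: cell_def)
  then have "M closure_of (cell \<Gamma> \<G> \<rho> c (Suc n))
      = \<rho> ?g ` (M closure_of (\<rho> (elabel \<G> ?e) ` vlabel \<G> (head \<G> ?e)))"
    using closure_of_image_action[OF g image_action_subset[OF elabel_closed[OF e] W]] by simp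
  then show ?thesis
    using closure_edge_subset[OF e] by (auto simp: cell_def)
qed

lemma cell_subset:
  assumes "fst c \<in> carrier \<Gamma>" "\<And>i. snd c i \<in> arcs \<G>"
  shows "cell \<Gamma> \<G> \<rho> c n \<subseteq> topspace M"
  unfolding cell_def
  using assms path_seq_closed tail_in_verts vlabel_subset by (intro image_action_subset) auto

lemma cell_Suc_subset:
  assumes "fst c \<in> carrier \<Gamma>" "\<And>i. snd c i \<in> arcs \<G>" "head \<G> (snd c n) = tail \<G> (snd c (Suc n))"
  shows "cell \<Gamma> \<G> \<rho> c (Suc n) \<subseteq> cell \<Gamma> \<G> \<rho> c n"
  using closure_cell_Suc_subset[OF assms] closure_of_subset[OF cell_subset[OF assms(1,2)]] by blast

lemma codingD:
  assumes "coding \<Gamma> \<G> c"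
  shows "fst c \<in> carrier \<Gamma>" "snd c i \<in> arcs \<G>" "head \<G> (snd c i) = tail \<G> (snd c (Suc i))"
  using assms by (simp_all only: coding_def)

lemma coding_cell_antimono:
  assumes "coding \<Gamma> \<G> c"
  shows "m \<le> n \<Longrightarrow> cell \<Gamma> \<G> \<rho> c n \<subseteq> cell \<Gamma> \<G> \<rho> c m"
  by (rule lift_Suc_antimono_le[of "cell \<Gamma> \<G> \<rho> c", OF cell_Suc_subset[OF codingD[OF assms]]])

text \<open>For \<open>n \<ge> 1\<close> the terminal vertex numbered \<open>n\<close> is the tail
  of the next edge, and the additional cell 0 contains cell 1, so it leaves the intersection
  unchanged.\<close>

lemma coded_set_eq:
  assumes "coding \<Gamma> \<G> c"
  shows "coded_set \<Gamma> \<G> \<rho> c = (\<Inter>n. cell \<Gamma> \<G> \<rho> c n)"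
proof -
  have "\<rho> (path_seq \<Gamma> \<G> c n) ` vlabel \<G> (terminal_vertex \<G> c n) = cell \<Gamma> \<G> \<rho> c n" if "n \<ge> 1" for n
    using that codingD(3)[OF assms, of "n - 1"] by (simp add: cell_def terminal_vertex_def)
  then have "coded_set \<Gamma> \<G> \<rho> c = (\<Inter>n\<in>{1..}. cell \<Gamma> \<G> \<rho> c n)"
    by (simp add: coded_set_def)
  also have "\<dots> = (\<Inter>n. cell \<Gamma> \<G> \<rho> c n)"
  proof (intro subset_antisym INF_greatest)
    fix n
    have "(\<Inter>n\<in>{1..}. cell \<Gamma> \<G> \<rho> c n) \<subseteq> cell \<Gamma> \<G> \<rho> c (Suc n)"
      by (rule INF_lower) simp
    also have "\<dots> \<subseteq> cell \<Gamma> \<G> \<rho> c n"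
      by (rule cell_Suc_subset[OF codingD[OF assms]])
    finally show "(\<Inter>n\<in>{1..}. cell \<Gamma> \<G> \<rho> c n) \<subseteq> cell \<Gamma> \<G> \<rho> c n" .
  qed (rule INF_lower[OF UNIV_I])
  finally show ?thesis .
qed

lemma coded_set_subset: "coding \<Gamma> \<G> c \<Longrightarrow> coded_set \<Gamma> \<G> \<rho> c \<subseteq> topspace M"
  using cell_subset[OF codingD(1,2), of c 0] coded_set_eq[of c] by blast

text \<open>If no cell lay in \<open>V\<close>, the sets \<open>D n\<close> would be a decreasing
  sequence of nonempty closed sets in a compact space. A common point lies in every cell, not just
  in every closure, because the closure of each cell is contained in the preceding cell.\<close>

lemma cell_eventually_subset:
  assumes c: "coding \<Gamma> \<G> c" and V: "openin M V" and sub: "coded_set \<Gamma> \<G> \<rho> c \<subseteq> V"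
  shows "\<exists>n. cell \<Gamma> \<G> \<rho> c n \<subseteq> V"
proof (rule ccontr)
  assume contra: "\<not> ?thesis"
  define D where "D n = M closure_of (cell \<Gamma> \<G> \<rho> c n) - V" for n
  have "(\<Inter>n. D n) \<noteq> {}"
  proof (rule compact_space_imp_nest[OF compact])
    show "closedin M (D n)" for n
      using V unfolding D_def by (intro closedin_diff) auto
    show "D n \<noteq> {}" for n
      using contra closure_of_subset[OF cell_subset[OF codingD(1,2)[OF c]]] unfolding D_def by blast
    show "decseq D"
      unfolding D_def using coding_cell_antimono[OF c]
      by (intro decseq_SucI Diff_mono closure_of_mono) auto
  qed
  then obtain x where x: "\<And>n. x \<in> D n" by auto
  then have "x \<in> cell \<Gamma> \<G> \<rho> c n" for n
    using closure_cell_Suc_subset[OF codingD[OF c], of n] x[of "Suc n"] unfolding D_def by blast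
  then show False
    using x[of 0] sub coded_set_eq[OF c] by (auto simp: D_def)
qed

text \<open>With \<open>V\<close> empty in \<open>cell_eventually_subset\<close>, an empty coded set
  would force an empty cell, yet each cell is the image of a nonempty label.\<close>

lemma coded_set_nonempty:
  assumes c: "coding \<Gamma> \<G> c" and ne: "\<And>v. v \<in> tail \<G> ` arcs \<G> \<Longrightarrow> vlabel \<G> v \<noteq> {}"
  shows "coded_set \<Gamma> \<G> \<rho> c \<noteq> {}"
proof
  assume "coded_set \<Gamma> \<G> \<rho> c = {}"
  then obtain n where "cell \<Gamma> \<G> \<rho> c n \<subseteq> {}"
    using cell_eventually_subset[OF c, of "{}"] by auto
  then show False
    using ne[of "tail \<G> (snd c n)"] codingD[OF c] by (auto simp: cell_def)
qed

section \<open>Translations and shifts of codings\<close>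

lemma path_seq_translate:
  assumes "coding \<Gamma> \<G> c" "g \<in> carrier \<Gamma>"
  shows "path_seq \<Gamma> \<G> (g \<otimes> fst c, snd c) n = g \<otimes> path_seq \<Gamma> \<G> c n"
proof (induction n)
  case (Suc n)
  then show ?case
    using assms(2) path_seq_closed[OF codingD(1,2)[OF assms(1)]] elabel_closed codingD[OF assms(1)]
    by (simp add: m_assoc)
qed simp

lemma coding_translate: "coding \<Gamma> \<G> c \<Longrightarrow> g \<in> carrier \<Gamma> \<Longrightarrow> coding \<Gamma> \<G> (g \<otimes> fst c, snd c)"
  by (simp add: coding_def)

text \<open>Changing the initial point by \<open>g\<close> multiplies the whole path sequence by
  \<open>g\<close> on the left and hence moves every cell by \<open>\<rho> g\<close>. Equivariance
  of the semiconjugacy comes from this identity.\<close>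

lemma coded_set_translate:
  assumes c: "coding \<Gamma> \<G> c" and g: "g \<in> carrier \<Gamma>"
  shows "coded_set \<Gamma> \<G> \<rho> (g \<otimes> fst c, snd c) = \<rho> g ` coded_set \<Gamma> \<G> \<rho> c"
proof -
  have "cell \<Gamma> \<G> \<rho> (g \<otimes> fst c, snd c) n = \<rho> g ` cell \<Gamma> \<G> \<rho> c n" for n
    unfolding cell_def snd_conv path_seq_translate[OF assms]
    using g path_seq_closed codingD[OF c] tail_in_verts vlabel_subset by (intro image_action_mult) auto
  then show ?thesis
    using coded_set_eq[OF c] coded_set_eq[OF coding_translate[OF assms]]
      image_inter_action[OF g cell_subset[OF codingD(1,2)[OF c]]] by simp
qed

lemma path_seq_shift:
  assumes "coding \<Gamma> \<G> c"
  shows "path_seq \<Gamma> \<G> c (n + k) = path_seq \<Gamma> \<G> c n \<otimes> path_seq \<Gamma> \<G> (\<one>, \<lambda>i. snd c (n + i)) k"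
proof (induction k)
  case 0
  then show ?case using path_seq_closed[OF codingD(1,2)[OF assms]] by simp
next
  case (Suc k)
  then show ?case
    using path_seq_closed codingD[OF assms] elabel_closed by (simp add: m_assoc)
qed

lemma coding_shift: "coding \<Gamma> \<G> c \<Longrightarrow> coding \<Gamma> \<G> (\<one>, \<lambda>i. snd c (n + i))"
  by (simp add: coding_def)

text \<open>Pulled back by the group element reached after \<open>n\<close> edges, a deep cell
  becomes a cell of bounded depth of a coding that starts at \<open>\<one>\<close>. This reduces
  statements about all depths to finitely many cells.\<close>

lemma cell_shift:
  assumes c: "coding \<Gamma> \<G> c"
  shows "cell \<Gamma> \<G> \<rho> c (n + k) = \<rho> (path_seq \<Gamma> \<G> c n) ` cell \<Gamma> \<G> \<rho> (\<one>, \<lambda>i. snd c (n + i)) k"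
  unfolding cell_def path_seq_shift[OF c] snd_conv
  using path_seq_closed codingD[OF c] tail_in_verts vlabel_subset by (intro image_action_mult) auto

text \<open>Each further edge multiplies the number of words by at most the number of edges.
  Composability of the edges is not imposed, which keeps the induction simple.\<close>

lemma finite_path_seq:
  "finite {path_seq \<Gamma> \<G> (g, t) n | t. \<forall>i. t i \<in> arcs \<G>}"
proof (induction n)
  case (Suc n)
  have "{path_seq \<Gamma> \<G> (g, t) (Suc n) | t. \<forall>i. t i \<in> arcs \<G>} \<subseteq>
      (\<lambda>(w, e). w \<otimes> elabel \<G> e) ` ({path_seq \<Gamma> \<G> (g, t) n | t. \<forall>i. t i \<in> arcs \<G>} \<times> arcs \<G>)"
    by force
  then show ?case
    using Suc finite_arcs by (meson finite_SigmaI finite_imageI finite_subset)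
qed simp

text \<open>The coder condition consists of one inclusion per edge, of the image of a compact
  closure in an open label, and there are finitely many edges.\<close>

lemma eventually_coder_action:
  "\<forall>\<^sub>F \<sigma> in nhdsin (action_topology \<Gamma> M) \<rho>. coder_action \<Gamma> M \<sigma> \<G>"
proof -
  have "\<forall>\<^sub>F \<sigma> in nhdsin (action_topology \<Gamma> M) \<rho>. \<forall>e\<in>arcs \<G>.
      \<sigma> (elabel \<G> e) ` (M closure_of vlabel \<G> (head \<G> e)) \<subseteq> vlabel \<G> (tail \<G> e)"
  proof (intro eventually_ball_finite ballI finite_arcs eventually_image_subset compactin_closure)
    fix e assume "e \<in> arcs \<G>"
    then show "elabel \<G> e \<in> carrier \<Gamma>" "openin M (vlabel \<G> (tail \<G> e))"
      "\<rho> (elabel \<G> e) ` (M closure_of vlabel \<G> (head \<G> e)) \<subseteq> vlabel \<G> (tail \<G> e)"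
      using elabel_closed openin_vlabel tail_in_verts closure_edge_subset
        closure_of_image_action[OF elabel_closed vlabel_subset[OF head_in_verts]] by auto
  qed
  then show ?thesis
    using eventually_homeo_action
  proof eventually_elim
    fix \<sigma>
    assume sub: "\<forall>e\<in>arcs \<G>. \<sigma> (elabel \<G> e) ` (M closure_of vlabel \<G> (head \<G> e)) \<subseteq> vlabel \<G> (tail \<G> e)"
      and "homeo_action \<Gamma> M \<sigma>"
    then interpret \<sigma>: homeo_action \<Gamma> M \<sigma> by simp
    show "coder_action \<Gamma> M \<sigma> \<G>"
    proof
      show "is_point_coder \<Gamma> M \<sigma> \<G>"
        using point_coder sub
          \<sigma>.closure_of_image_action[OF elabel_closed vlabel_subset[OF head_in_verts]]
        by (simp add: is_point_coder_def)
    qed (rule compact)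
  qed
qed

end


section \<open>Comparing codings of the same point\<close>

text \<open>Koenig's lemma, obtained from compactness of a countable power of the finite discrete
  space \<open>E\<close>. A finite path is represented by a total sequence; \<open>local\<close>
  says that its values beyond \<open>n\<close> are irrelevant to \<open>P n\<close>, which makes
  each set of solutions closed.\<close>

lemma infinite_path_of_finite_paths:
  fixes P :: "nat \<Rightarrow> (nat \<Rightarrow> 'e) \<Rightarrow> bool"
  assumes fin: "finite E"
    and range: "\<And>n t. P n t \<Longrightarrow> range t \<subseteq> E"
    and mono: "\<And>n t. P (Suc n) t \<Longrightarrow> P n t"
    and local: "\<And>n t t'. P n t \<Longrightarrow> range t' \<subseteq> E \<Longrightarrow> (\<And>i. i \<le> n \<Longrightarrow> t' i = t i) \<Longrightarrow> P n t'"
    and ex: "\<And>n. \<exists>t. P n t"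
  shows "\<exists>t. \<forall>n. P n t"
proof -
  let ?X = "product_topology (\<lambda>_::nat. discrete_topology E) UNIV"
  have space: "topspace ?X = {t. range t \<subseteq> E}"
    by (auto simp: PiE_UNIV_domain)
  have "(\<Inter>n. {t. P n t}) \<noteq> {}"
  proof (rule compact_space_imp_nest)
    show "compact_space ?X"
      using fin by (simp add: compact_space_product_topology compact_space_discrete_topology)
    show "{t. P n t} \<noteq> {}" for n
      using ex by simp
    show "decseq (\<lambda>n. {t. P n t})"
      using mono by (intro decseq_SucI) blast
    show "closedin ?X {t. P n t}" for n
    proof -
      have "openin ?X (topspace ?X - {t. P n t})"
      proof (subst openin_subopen, intro ballI)
        fix t assume t: "t \<in> topspace ?X - {t. P n t}"
        \<comment> \<open>The cylinder of the sequences that agree with \<open>t\<close> up to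
          \<open>n\<close>: by \<open>local\<close> none of them satisfies
          \<open>P n\<close>.\<close>
        let ?C = "PiE UNIV (\<lambda>i. if i \<le> n then {t i} else E)"
        have rt: "range t \<subseteq> E" using t space by blast
        have "openin ?X ?C"
        proof (rule product_topology_basis)
          show "openin (discrete_topology E) (if i \<le> n then {t i} else E)" for i
            using rt by auto
          show "finite {i. (if i \<le> n then {t i} else E) \<noteq> topspace (discrete_topology E)}"
            by (rule finite_subset[of _ "{..n}"]) auto
        qed
        moreover have "t \<in> ?C"
          using rt by (simp add: PiE_UNIV_domain Pi_iff image_subset_iff)
        moreover have "?C \<subseteq> topspace ?X - {t. P n t}"
        proof
          fix u assume u: "u \<in> ?C"
          have ui: "u i \<in> (if i \<le> n then {t i} else E)" for i
            using PiE_mem[OF u] by blast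
          have eq: "u i = t i" if "i \<le> n" for i
            using ui[of i] that by simp
          have ru: "range u \<subseteq> E"
            using ui rt by (metis UNIV_I image_subset_iff singletonD)
          have "\<not> P n u"
            using local[of n u t] rt eq t by auto
          then show "u \<in> topspace ?X - {t. P n t}"
            using ru space by blast
        qed
        ultimately show "\<exists>T. openin ?X T \<and> t \<in> T \<and> T \<subseteq> topspace ?X - {t. P n t}"
          by blast
      qed
      then show ?thesis
        using range space by (auto simp: closedin_def)
    qed
  qed
  then show ?thesis by auto
qed

section \<open>Uniform contraction and persistence of inclusions between cells\<close>

context coder_action
begin

text \<open>A limit of codings violating both alternatives would code a point lying neither in \<open>V\<close>
  nor in the complement of \<open>C\<close>.\<close>

lemma uniform_cell_alternative:
  assumes contr: "contracting \<Gamma> \<G> \<rho>" and C: "closedin M C" and V: "openin M V" and "C \<subseteq> V"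
  shows "\<exists>N. \<forall>t. coding \<Gamma> \<G> (\<one>, t) \<longrightarrow>
    cell \<Gamma> \<G> \<rho> (\<one>, t) N \<inter> C = {} \<or> M closure_of (cell \<Gamma> \<G> \<rho> (\<one>, t) N) \<subseteq> V"
proof (rule ccontr)
  assume contra: "\<not> ?thesis"
  \<comment> \<open>Matching is required for \<open>i < n\<close> only, so that \<open>P n\<close>
    involves no edge beyond number \<open>n\<close>. For the limit path, composability at
    \<open>n\<close> is then read off from \<open>P (Suc n)\<close>.\<close>
  define P where "P n t \<longleftrightarrow> range t \<subseteq> arcs \<G> \<and> (\<forall>i<n. head \<G> (t i) = tail \<G> (t (Suc i))) \<and>
    cell \<Gamma> \<G> \<rho> (\<one>, t) n \<inter> C \<noteq> {} \<and> \<not> M closure_of (cell \<Gamma> \<G> \<rho> (\<one>, t) n) \<subseteq> V" for n t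
  have "\<exists>t. \<forall>n. P n t"
  proof (rule infinite_path_of_finite_paths[OF finite_arcs])
    show "range t \<subseteq> arcs \<G>" if "P n t" for n t
      using that by (simp add: P_def)
    show "P n t" if "P (Suc n) t" for n t
    proof -
      have "cell \<Gamma> \<G> \<rho> (\<one>, t) (Suc n) \<subseteq> cell \<Gamma> \<G> \<rho> (\<one>, t) n"
        using that by (intro cell_Suc_subset) (auto simp: P_def)
      then show ?thesis
        using that closure_of_mono unfolding P_def by (meson disjoint_iff less_SucI order_trans subsetD)
    qed
    show "P n u" if "P n t" "range u \<subseteq> arcs \<G>" "\<And>i. i \<le> n \<Longrightarrow> u i = t i" for n t u
      using that cell_cong[of "(\<one>, u)" "(\<one>, t)" n \<Gamma> \<G> \<rho>] unfolding P_def by simp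
    show "\<exists>t. P n t" for n
    proof -
      obtain t where "coding \<Gamma> \<G> (\<one>, t)" "cell \<Gamma> \<G> \<rho> (\<one>, t) n \<inter> C \<noteq> {}"
        "\<not> M closure_of (cell \<Gamma> \<G> \<rho> (\<one>, t) n) \<subseteq> V"
        using contra by blast
      then have "P n t"
        unfolding P_def by (auto simp: coding_def)
      then show ?thesis by blast
    qed
  qed
  then obtain t where t: "\<And>n. P n t" by blast
  have c: "coding \<Gamma> \<G> (\<one>, t)"
    unfolding coding_def
  proof (intro conjI allI)
    fix n
    show "snd (\<one>, t) n \<in> arcs \<G>" "head \<G> (snd (\<one>, t) n) = tail \<G> (snd (\<one>, t) (Suc n))"
      using t[of "Suc n"] unfolding P_def by auto
  qed simp
  obtain p where p: "coded_set \<Gamma> \<G> \<rho> (\<one>, t) = {p}"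
    using contr c unfolding contracting_def by blast
  show False
  proof (cases "p \<in> V")
    case True
    then obtain n where "cell \<Gamma> \<G> \<rho> (\<one>, t) n \<subseteq> V"
      using cell_eventually_subset[OF c V] p by auto
    then show False
      using t[of "Suc n"] closure_cell_Suc_subset[OF codingD[OF c], of n] unfolding P_def by blast
  next
    case False
    moreover have "p \<in> topspace M"
      using p coded_set_subset[OF c] by blast
    ultimately have "coded_set \<Gamma> \<G> \<rho> (\<one>, t) \<subseteq> topspace M - C"
      using p \<open>C \<subseteq> V\<close> by auto
    then obtain n where "cell \<Gamma> \<G> \<rho> (\<one>, t) n \<subseteq> topspace M - C"
      using cell_eventually_subset[OF c, of "topspace M - C"] C by (auto simp: closedin_def)
    then show False
      using t[of n] unfolding P_def by blast
  qed
qed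

text \<open>At the uniform depth \<open>N\<close> a cell that meets \<open>C\<close> has its closure
  inside \<open>\<rho> f\<close> \<open>V\<close>. A cell of that depth is determined by a word and
  a vertex, so only finitely many inclusions have to survive the perturbation.\<close>

lemma eventually_cell_subset:
  assumes contr: "contracting \<Gamma> \<G> \<rho>" and f: "f \<in> carrier \<Gamma>"
    and C: "closedin M C" and V: "openin M V" and sub: "C \<subseteq> \<rho> f ` V"
  shows "\<exists>N. \<forall>\<^sub>F \<sigma> in nhdsin (action_topology \<Gamma> M) \<rho>. \<forall>t.
    coding \<Gamma> \<G> (\<one>, t) \<and> cell \<Gamma> \<G> \<rho> (\<one>, t) N \<inter> C \<noteq> {} \<longrightarrow> cell \<Gamma> \<G> \<sigma> (\<one>, t) N \<subseteq> \<sigma> f ` V"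
proof -
  have VM: "V \<subseteq> topspace M" using V openin_subset by blast
  obtain N where N: "\<And>t. coding \<Gamma> \<G> (\<one>, t) \<Longrightarrow>
      cell \<Gamma> \<G> \<rho> (\<one>, t) N \<inter> C = {} \<or> M closure_of (cell \<Gamma> \<G> \<rho> (\<one>, t) N) \<subseteq> \<rho> f ` V"
    using uniform_cell_alternative[OF contr C openin_image_action[OF f V] sub] by blast
  \<comment> \<open>The pairs of word and vertex whose inclusion holds for \<open>\<rho>\<close>.
    Pulling back by \<open>f\<close> leaves the fixed open target \<open>V\<close>, which no longer
    moves with the action, so each inclusion is an open condition.\<close>
  define Q where "Q = {(w, v). (\<exists>t. w = path_seq \<Gamma> \<G> (\<one>, t) N \<and> (\<forall>i. t i \<in> arcs \<G>)) \<and> v \<in> verts \<G> \<and>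
    \<rho> (inv f \<otimes> w) ` (M closure_of vlabel \<G> v) \<subseteq> V}"
  have "Q \<subseteq> {path_seq \<Gamma> \<G> (\<one>, t) N | t. \<forall>i. t i \<in> arcs \<G>} \<times> verts \<G>"
    unfolding Q_def by blast
  then have "finite Q"
    by (rule finite_subset) (intro finite_SigmaI finite_path_seq finite_verts)
  moreover have "\<forall>\<^sub>F \<sigma> in nhdsin (action_topology \<Gamma> M) \<rho>.
      \<sigma> (inv f \<otimes> fst x) ` (M closure_of vlabel \<G> (snd x)) \<subseteq> V" if "x \<in> Q" for x
  proof (rule eventually_image_subset[OF _ compactin_closure V])
    show "inv f \<otimes> fst x \<in> carrier \<Gamma>"
      using that path_seq_closed f unfolding Q_def by force
    show "\<rho> (inv f \<otimes> fst x) ` (M closure_of vlabel \<G> (snd x)) \<subseteq> V"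
      using that unfolding Q_def by auto
  qed
  ultimately have "\<forall>\<^sub>F \<sigma> in nhdsin (action_topology \<Gamma> M) \<rho>. \<forall>x\<in>Q.
      \<sigma> (inv f \<otimes> fst x) ` (M closure_of vlabel \<G> (snd x)) \<subseteq> V"
    by (intro eventually_ball_finite ballI)
  then have "\<forall>\<^sub>F \<sigma> in nhdsin (action_topology \<Gamma> M) \<rho>. \<forall>t.
    coding \<Gamma> \<G> (\<one>, t) \<and> cell \<Gamma> \<G> \<rho> (\<one>, t) N \<inter> C \<noteq> {} \<longrightarrow> cell \<Gamma> \<G> \<sigma> (\<one>, t) N \<subseteq> \<sigma> f ` V"
    using eventually_homeo_action
  proof eventually_elim
    fix \<sigma>
    assume Q: "\<forall>x\<in>Q. \<sigma> (inv f \<otimes> fst x) ` (M closure_of vlabel \<G> (snd x)) \<subseteq> V"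
      and "homeo_action \<Gamma> M \<sigma>"
    then interpret \<sigma>: homeo_action \<Gamma> M \<sigma> by simp
    show "\<forall>t. coding \<Gamma> \<G> (\<one>, t) \<and> cell \<Gamma> \<G> \<rho> (\<one>, t) N \<inter> C \<noteq> {} \<longrightarrow>
        cell \<Gamma> \<G> \<sigma> (\<one>, t) N \<subseteq> \<sigma> f ` V"
    proof (intro allI impI)
      fix t assume t: "coding \<Gamma> \<G> (\<one>, t) \<and> cell \<Gamma> \<G> \<rho> (\<one>, t) N \<inter> C \<noteq> {}"
      let ?w = "path_seq \<Gamma> \<G> (\<one>, t) N" and ?v = "tail \<G> (t N)"
      let ?W = "vlabel \<G> ?v"
      have arcs: "t i \<in> arcs \<G>" for i
        using codingD(2)[of "(\<one>, t)"] t by simp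
      have w: "?w \<in> carrier \<Gamma>" and v: "?v \<in> verts \<G>"
        using path_seq_closed[of "(\<one>, t)"] arcs tail_in_verts by auto
      have if_: "inv f \<in> carrier \<Gamma>" "inv f \<otimes> ?w \<in> carrier \<Gamma>"
        using f w by auto
      have "\<rho> ?w ` (M closure_of ?W) = M closure_of (cell \<Gamma> \<G> \<rho> (\<one>, t) N)"
        using closure_of_image_action[OF w vlabel_subset[OF v]] by (simp add: cell_def)
      also have "\<dots> \<subseteq> \<rho> f ` V"
        using N t by blast
      finally have "\<rho> (inv f) ` \<rho> ?w ` (M closure_of ?W) \<subseteq> \<rho> (inv f) ` \<rho> f ` V"
        by (rule image_mono)
      also have "\<rho> (inv f) ` \<rho> f ` V = V"
        using image_action_mult[OF if_(1) f VM] f VM action_one by (auto simp: subset_iff)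
      also have "\<rho> (inv f) ` \<rho> ?w ` (M closure_of ?W) = \<rho> (inv f \<otimes> ?w) ` (M closure_of ?W)"
        using image_action_mult[OF if_(1) w closure_of_subset_topspace] by simp
      finally have "(?w, ?v) \<in> Q"
        unfolding Q_def using v arcs by blast
      then have "\<sigma> (inv f \<otimes> ?w) ` (M closure_of ?W) \<subseteq> V"
        using Q by force
      then have *: "\<sigma> (inv f \<otimes> ?w) ` ?W \<subseteq> V"
        using closure_of_subset[OF vlabel_subset[OF v]] by blast
      have "cell \<Gamma> \<G> \<sigma> (\<one>, t) N = \<sigma> (f \<otimes> (inv f \<otimes> ?w)) ` ?W"
        using f w by (simp add: cell_def m_assoc[symmetric])
      also have "\<dots> = \<sigma> f ` \<sigma> (inv f \<otimes> ?w) ` ?W"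
        by (rule \<sigma>.image_action_mult[OF f if_(2) vlabel_subset[OF v]])
      also have "\<dots> \<subseteq> \<sigma> f ` V"
        using * by (rule image_mono)
      finally show "cell \<Gamma> \<G> \<sigma> (\<one>, t) N \<subseteq> \<sigma> f ` V" .
    qed
  qed
  then show ?thesis ..
qed

text \<open>A cell of \<open>c\<close> is contained in a given cell of \<open>d\<close> once the two indices are related by \<open>F\<close> and
  a bounded number \<open>N\<close> of further edges of \<open>c\<close> is read; after translation this is one of finitely
  many inclusions, each of which persists under perturbation.\<close>

lemma eventually_coded_set_subset:
  assumes contr: "contracting \<Gamma> \<G> \<rho>" and H: "coder_action \<Gamma> M \<rho> \<H>"
    and F: "finite F" "F \<subseteq> carrier \<Gamma>"
  shows "\<forall>\<^sub>F \<sigma> in nhdsin (action_topology \<Gamma> M) \<rho>. \<forall>q c d.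
    coding_of \<Gamma> \<G> \<rho> c q \<and> coding_of \<Gamma> \<H> \<rho> d q \<and>
    F_close \<Gamma> F (path_seq \<Gamma> \<G> c) (path_seq \<Gamma> \<H> d) \<longrightarrow>
    coded_set \<Gamma> \<G> \<sigma> c \<subseteq> coded_set \<Gamma> \<H> \<sigma> d"
proof -
  interpret H: coder_action \<Gamma> M \<rho> \<H> by (rule H)
  \<comment> \<open>For \<open>x = (f, e)\<close> this closed set lies in the image under
    \<open>\<rho> f\<close> of the label at the tail of \<open>e\<close>, by the edge condition for
    \<open>e\<close>. The edge thus supplies the room that the perturbation needs.\<close>
  define C where "C x = M closure_of (\<rho> (fst x \<otimes> elabel \<H> (snd x)) ` vlabel \<H> (head \<H> (snd x)))" for x
  define good where "good x N \<sigma> \<longleftrightarrow> (\<forall>t. coding \<Gamma> \<G> (\<one>, t) \<and> cell \<Gamma> \<G> \<rho> (\<one>, t) N \<inter> C x \<noteq> {} \<longrightarrow>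
    cell \<Gamma> \<G> \<sigma> (\<one>, t) N \<subseteq> \<sigma> (fst x) ` vlabel \<H> (tail \<H> (snd x)))" for x N \<sigma>
  have "\<exists>N. \<forall>\<^sub>F \<sigma> in nhdsin (action_topology \<Gamma> M) \<rho>. good x N \<sigma>" if x: "x \<in> F \<times> arcs \<H>" for x
    unfolding good_def
  proof (rule eventually_cell_subset[OF contr])
    have f: "fst x \<in> carrier \<Gamma>" and e: "snd x \<in> arcs \<H>"
      using x F by auto
    have W: "vlabel \<H> (head \<H> (snd x)) \<subseteq> topspace M"
      by (rule H.vlabel_subset[OF H.head_in_verts[OF e]])
    have "C x = \<rho> (fst x) ` (M closure_of (\<rho> (elabel \<H> (snd x)) ` vlabel \<H> (head \<H> (snd x))))"
      unfolding C_def image_action_mult[OF f H.elabel_closed[OF e] W]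
      by (rule closure_of_image_action[OF f image_action_subset[OF H.elabel_closed[OF e] W]])
    then show "C x \<subseteq> \<rho> (fst x) ` vlabel \<H> (tail \<H> (snd x))"
      using H.closure_edge_subset[OF e] by auto
    show "fst x \<in> carrier \<Gamma>" by (rule f)
    show "closedin M (C x)" by (simp add: C_def)
    show "openin M (vlabel \<H> (tail \<H> (snd x)))"
      by (rule H.openin_vlabel[OF H.tail_in_verts[OF e]])
  qed
  then obtain N where "\<forall>x \<in> F \<times> arcs \<H>. \<forall>\<^sub>F \<sigma> in nhdsin (action_topology \<Gamma> M) \<rho>. good x (N x) \<sigma>"
    by metis
  then have "\<forall>\<^sub>F \<sigma> in nhdsin (action_topology \<Gamma> M) \<rho>. \<forall>x \<in> F \<times> arcs \<H>. good x (N x) \<sigma>"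
    by (intro eventually_ball_finite finite_SigmaI F(1) H.finite_arcs)
  then show ?thesis
    using eventually_coder_action H.eventually_coder_action
  proof eventually_elim
    fix \<sigma>
    assume good: "\<forall>x \<in> F \<times> arcs \<H>. good x (N x) \<sigma>"
      and "coder_action \<Gamma> M \<sigma> \<G>" "coder_action \<Gamma> M \<sigma> \<H>"
    then interpret \<sigma>: coder_action \<Gamma> M \<sigma> \<G> + \<sigma>H: coder_action \<Gamma> M \<sigma> \<H> by simp_all
    show "\<forall>q c d. coding_of \<Gamma> \<G> \<rho> c q \<and> coding_of \<Gamma> \<H> \<rho> d q \<and>
        F_close \<Gamma> F (path_seq \<Gamma> \<G> c) (path_seq \<Gamma> \<H> d) \<longrightarrow>
        coded_set \<Gamma> \<G> \<sigma> c \<subseteq> coded_set \<Gamma> \<H> \<sigma> d"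
    proof (intro allI impI, elim conjE)
      fix q c d
      assume c: "coding_of \<Gamma> \<G> \<rho> c q" and d: "coding_of \<Gamma> \<H> \<rho> d q"
        and close: "F_close \<Gamma> F (path_seq \<Gamma> \<G> c) (path_seq \<Gamma> \<H> d)"
      have cc: "coding \<Gamma> \<G> c" and dd: "coding \<Gamma> \<H> d"
        using c d by (auto simp: coding_of_def)
      have q: "q \<in> cell \<Gamma> \<G> \<rho> c k" "q \<in> cell \<Gamma> \<H> \<rho> d k" for k
        using c d coded_set_eq[OF cc] H.coded_set_eq[OF dd] by (auto simp: coding_of_def)
      have "coded_set \<Gamma> \<G> \<sigma> c \<subseteq> cell \<Gamma> \<H> \<sigma> d k" for k
      proof -
        \<comment> \<open>The choice \<open>m > k\<close> allows cell \<open>k\<close> of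
          \<open>d\<close> to be replaced by its smaller cell \<open>m\<close>.\<close>
        obtain n m where m: "m > k"
          and F_mem: "inv (path_seq \<Gamma> \<G> c n) \<otimes> path_seq \<Gamma> \<H> d m \<in> F"
          using close unfolding F_close_def by blast
        define g f e t where "g = path_seq \<Gamma> \<G> c n" and "f = inv g \<otimes> path_seq \<Gamma> \<H> d m"
          and "e = snd d m" and "t = (\<lambda>i. snd c (n + i))"
        have g: "g \<in> carrier \<Gamma>"
          unfolding g_def by (rule path_seq_closed[OF codingD(1,2)[OF cc]])
        have fF: "f \<in> F" and f: "f \<in> carrier \<Gamma>"
          using F_mem F(2) by (auto simp: f_def g_def)
        have h: "path_seq \<Gamma> \<H> d m = g \<otimes> f"
          unfolding f_def using g H.path_seq_closed[OF H.codingD(1,2)[OF dd]]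
          by (simp add: m_assoc[symmetric])
        have e: "e \<in> arcs \<H>" and "head \<H> e = tail \<H> (snd d (Suc m))"
          unfolding e_def using H.codingD[OF dd] by auto
        note el = H.elabel_closed[OF e]
        have fe: "f \<otimes> elabel \<H> e \<in> carrier \<Gamma>" using f el by simp
        have W: "vlabel \<H> (head \<H> e) \<subseteq> topspace M" "vlabel \<H> (tail \<H> e) \<subseteq> topspace M"
          using e H.vlabel_subset H.head_in_verts H.tail_in_verts by auto
        let ?N = "N (f, e)"
        have t: "coding \<Gamma> \<G> (\<one>, t)"
          unfolding t_def by (rule coding_shift[OF cc])
        have "q \<in> \<rho> g ` cell \<Gamma> \<G> \<rho> (\<one>, t) ?N"
          using q(1)[of "n + ?N"] cell_shift[OF cc, of n ?N] by (simp add: g_def t_def)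
        then obtain y where y: "y \<in> cell \<Gamma> \<G> \<rho> (\<one>, t) ?N" "q = \<rho> g y" by blast
        have yM: "y \<in> topspace M"
          using y(1) cell_subset[OF codingD(1,2)[OF t]] by blast
        \<comment> \<open>One more edge of \<open>d\<close> than the target cell \<open>m\<close>:
          the cell at \<open>Suc m\<close>, pulled back by \<open>g\<close>, lies in
          \<open>C (f, e)\<close>. Hence the pulled-back point \<open>y\<close> witnesses that the
          shifted cell of \<open>c\<close> meets \<open>C (f, e)\<close>.\<close>
        have "cell \<Gamma> \<H> \<rho> d (Suc m) = \<rho> (g \<otimes> (f \<otimes> elabel \<H> e)) ` vlabel \<H> (head \<H> e)"
          using h g f el \<open>head \<H> e = _\<close> by (simp add: cell_def e_def m_assoc)
        also have "\<dots> = \<rho> g ` \<rho> (f \<otimes> elabel \<H> e) ` vlabel \<H> (head \<H> e)"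
          by (rule image_action_mult[OF g fe W(1)])
        finally have "\<rho> g y \<in> \<rho> g ` \<rho> (f \<otimes> elabel \<H> e) ` vlabel \<H> (head \<H> e)"
          using q(2)[of "Suc m"] y(2) by simp
        then have "y \<in> \<rho> (f \<otimes> elabel \<H> e) ` vlabel \<H> (head \<H> e)"
          using mem_image_action_iff[OF g image_action_subset[OF fe W(1)] action_closed[OF g yM]]
            action_inv(1)[OF g yM] by simp
        then have "y \<in> C (f, e)"
          unfolding C_def using closure_of_subset[OF image_action_subset[OF fe W(1)]] by auto
        then have *: "cell \<Gamma> \<G> \<sigma> (\<one>, t) ?N \<subseteq> \<sigma> f ` vlabel \<H> (tail \<H> e)"
          using good fF e t y(1) unfolding good_def by fastforce
        have "coded_set \<Gamma> \<G> \<sigma> c \<subseteq> cell \<Gamma> \<G> \<sigma> c (n + ?N)"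
          using \<sigma>.coded_set_eq[OF cc] by blast
        also have "\<dots> = \<sigma> g ` cell \<Gamma> \<G> \<sigma> (\<one>, t) ?N"
          using \<sigma>.cell_shift[OF cc] by (simp add: g_def t_def)
        also have "\<dots> \<subseteq> \<sigma> g ` \<sigma> f ` vlabel \<H> (tail \<H> e)"
          using * by (rule image_mono)
        also have "\<dots> = cell \<Gamma> \<H> \<sigma> d m"
          using \<sigma>.image_action_mult[OF g f W(2)] h by (simp add: cell_def e_def)
        also have "\<dots> \<subseteq> cell \<Gamma> \<H> \<sigma> d k"
          using \<sigma>H.coding_cell_antimono[OF dd] m by simp
        finally show ?thesis .
      qed
      then show "coded_set \<Gamma> \<G> \<sigma> c \<subseteq> coded_set \<Gamma> \<H> \<sigma> d"
        using \<sigma>H.coded_set_eq[OF dd] by blast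
    qed
  qed
qed

end


section \<open>Semiconjugacies from proto-coders\<close>

text \<open>The graph is generated by \<open>\<rho>\<^sub>0\<close>, while the cells are formed with
  \<open>\<rho>\<close>. By \<open>edgeI\<close> the graph has every edge that \<open>\<rho>\<close>
  would generate, so following a point under \<open>\<rho>\<close> still produces paths in this
  fixed graph.\<close>

locale proto_coder_action = coder_action \<Gamma> M \<rho> "generated_coder M \<S> \<rho>\<^sub>0"
  for \<Gamma> :: "('g, 'b) monoid_scheme" (structure) and M :: "'m topology"
    and \<rho> \<rho>\<^sub>0 and \<S> :: "('z, 'g, 'm) proto_coder" +
  assumes proto_coder: "is_proto_coder \<Gamma> M \<S>"
    and edgeI: "\<And>z y x. z \<in> index \<S> \<Longrightarrow> y \<in> index \<S> \<Longrightarrow> x \<in> Uset \<S> y \<Longrightarrow>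
      \<rho> (label \<S> z) x \<in> Uset \<S> z \<Longrightarrow> (z, y) \<in> arcs (generated_coder M \<S> \<rho>\<^sub>0)"
begin

section \<open>Codings that follow a point through the smaller covering\<close>

abbreviation "\<G> \<equiv> generated_coder M \<S> \<rho>\<^sub>0"

text \<open>Greedy codings: the point stays in the sets \<open>Uset\<close> and not merely in the
  labels \<open>Wset\<close>. Since edges are defined through \<open>Uset\<close>, a tracking prefix
  can always be continued, and it can be shared by nearby points.\<close>

definition tracks :: "'g \<times> (nat \<Rightarrow> 'z \<times> 'z) \<Rightarrow> 'm \<Rightarrow> bool" where
  "tracks c p \<longleftrightarrow> coding \<Gamma> \<G> c \<and> (\<forall>n. p \<in> \<rho> (path_seq \<Gamma> \<G> c n) ` Uset \<S> (fst (snd c n)))"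

lemma generated_coder_simps:
  "tail \<G> = fst" "head \<G> = snd" "vlabel \<G> = Wset \<S>" "elabel \<G> = (\<lambda>e. label \<S> (fst e))"
  by (auto simp: generated_coder_def)

lemma label_closed: "z \<in> index \<S> \<Longrightarrow> label \<S> z \<in> carrier \<Gamma>"
  and openin_Uset: "z \<in> index \<S> \<Longrightarrow> openin M (Uset \<S> z)"
  and Uset_subset_Wset: "z \<in> index \<S> \<Longrightarrow> Uset \<S> z \<subseteq> Wset \<S> z"
  and Uset_cover: "x \<in> topspace M \<Longrightarrow> \<exists>z\<in>index \<S>. x \<in> Uset \<S> z"
  using proto_coder by (auto simp: is_proto_coder_def)

lemma Uset_subset: "z \<in> index \<S> \<Longrightarrow> Uset \<S> z \<subseteq> topspace M"
  using openin_Uset openin_subset by blast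

lemma arc_index: "e \<in> arcs \<G> \<Longrightarrow> fst e \<in> index \<S> \<and> snd e \<in> index \<S>"
  by (auto simp: generated_coder_def)

lemma tracks_coding_of:
  assumes "tracks c p"
  shows "coding_of \<Gamma> \<G> \<rho> c p"
proof -
  have c: "coding \<Gamma> \<G> c" using assms by (simp add: tracks_def)
  have "p \<in> cell \<Gamma> \<G> \<rho> c n" for n
    using assms Uset_subset_Wset arc_index[OF codingD(2)[OF c, of n]]
    unfolding tracks_def cell_def generated_coder_simps by blast
  then show ?thesis
    using c coded_set_eq[OF c] by (simp add: coding_of_def)
qed

text \<open>After the prescribed prefix, the pulled-back point lies in some \<open>Uset\<close>
  because these sets cover the space, and \<open>edgeI\<close> joins consecutive choices by an
  edge.\<close>

lemma ex_tracks_extending: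
  assumes p: "p \<in> topspace M"
    and pre: "\<And>i. i \<le> k \<Longrightarrow> w i \<in> carrier \<Gamma> \<and> z i \<in> index \<S> \<and> p \<in> \<rho> (w i) ` Uset \<S> (z i)"
    and step: "\<And>i. i < k \<Longrightarrow> w (Suc i) = w i \<otimes> label \<S> (z i)"
  shows "\<exists>c. tracks c p \<and> fst c = w 0 \<and> (\<forall>i\<le>k. fst (snd c i) = z i)"
proof -
  \<comment> \<open>A state is a pair of current word and current vertex; it is forced up to stage
    \<open>k\<close> and free afterwards.\<close>
  define P where "P n s \<longleftrightarrow> fst s \<in> carrier \<Gamma> \<and> snd s \<in> index \<S> \<and>
    p \<in> \<rho> (fst s) ` Uset \<S> (snd s) \<and> (n \<le> k \<longrightarrow> s = (w n, z n))" for n s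
  have "\<exists>s. \<forall>n. P n (s n) \<and> fst (s (Suc n)) = fst (s n) \<otimes> label \<S> (snd (s n))"
  proof (rule dependent_nat_choice)
    show "\<exists>s. P 0 s"
      using pre[of 0] unfolding P_def by (intro exI[of _ "(w 0, z 0)"]) simp
    fix s n assume s: "P n s"
    show "\<exists>s'. P (Suc n) s' \<and> fst s' = fst s \<otimes> label \<S> (snd s)"
    proof (cases "Suc n \<le> k")
      case True
      then show ?thesis
        using pre[of "Suc n"] step[of n] s unfolding P_def
        by (intro exI[of _ "(w (Suc n), z (Suc n))"]) simp
    next
      case False
      let ?w = "fst s \<otimes> label \<S> (snd s)"
      have w: "?w \<in> carrier \<Gamma>"
        using s label_closed unfolding P_def by simp
      then obtain y where y: "y \<in> index \<S>" "\<rho> (inv ?w) p \<in> Uset \<S> y"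
        using Uset_cover[OF action_closed[OF inv_closed[OF w] p]] by blast
      then have "p \<in> \<rho> ?w ` Uset \<S> y"
        using mem_image_action_iff[OF w Uset_subset p] by blast
      then show ?thesis
        using False w y unfolding P_def by (intro exI[of _ "(?w, y)"]) simp
    qed
  qed
  then obtain s where s: "\<And>n. P n (s n)"
    and s_step: "\<And>n. fst (s (Suc n)) = fst (s n) \<otimes> label \<S> (snd (s n))"
    by blast
  define c where "c = (w 0, \<lambda>n. (snd (s n), snd (s (Suc n))))"
  have arc: "(snd (s n), snd (s (Suc n))) \<in> arcs \<G>" for n
  proof -
    have n: "fst (s n) \<in> carrier \<Gamma>" "snd (s n) \<in> index \<S>" "p \<in> \<rho> (fst (s n)) ` Uset \<S> (snd (s n))"
      using s[of n] by (auto simp: P_def)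
    have Sn: "snd (s (Suc n)) \<in> index \<S>" "p \<in> \<rho> (fst (s (Suc n))) ` Uset \<S> (snd (s (Suc n)))"
      using s[of "Suc n"] by (auto simp: P_def)
    note l = label_closed[OF n(2)]
    obtain x where x: "x \<in> Uset \<S> (snd (s (Suc n)))" "p = \<rho> (fst (s n) \<otimes> label \<S> (snd (s n))) x"
      using Sn(2) s_step by auto
    then have xM: "x \<in> topspace M"
      using Uset_subset[OF Sn(1)] by blast
    \<comment> \<open>Here \<open>x\<close> is \<open>p\<close> pulled back by the word of stage
      \<open>Suc n\<close>, and its image under the label is \<open>p\<close> pulled back by the
      word of stage \<open>n\<close>. Both lie in the chosen sets \<open>Uset\<close>, as
      \<open>edgeI\<close> requires.\<close>
    have "p = \<rho> (fst (s n)) (\<rho> (label \<S> (snd (s n))) x)"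
      using x(2) action_mult[OF n(1) l xM] by simp
    then have "\<rho> (label \<S> (snd (s n))) x \<in> Uset \<S> (snd (s n))"
      using n(3) mem_image_action_iff[OF n(1) Uset_subset[OF n(2)] p]
        action_inv(1)[OF n(1) action_closed[OF l xM]] by simp
    then show ?thesis
      by (rule edgeI[OF n(2) Sn(1) x(1)])
  qed
  have c0: "s 0 = (w 0, z 0)"
    using s[of 0] by (simp add: P_def)
  have "path_seq \<Gamma> \<G> c n = fst (s n)" for n
    by (induction n) (simp_all add: c_def c0 generated_coder_simps s_step)
  moreover have "coding \<Gamma> \<G> c"
    using pre[of 0] arc by (simp add: coding_def c_def generated_coder_simps)
  ultimately have "tracks c p"
    using s by (simp add: tracks_def P_def c_def)
  moreover have "\<forall>i\<le>k. fst (snd c i) = z i"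
    using s by (auto simp: c_def P_def)
  ultimately show ?thesis
    by (intro exI[of _ c]) (simp add: c_def)
qed

lemma ex_tracks:
  assumes "p \<in> topspace M" "g \<in> carrier \<Gamma>" "z \<in> index \<S>" "p \<in> \<rho> g ` Uset \<S> z"
  shows "\<exists>c. tracks c p \<and> fst c = g \<and> fst (snd c 0) = z"
  using ex_tracks_extending[of p 0 "\<lambda>_. g" "\<lambda>_. z"] assms by auto

lemma image_one: "A \<subseteq> topspace M \<Longrightarrow> \<rho> \<one> ` A = A"
  using action_one by (auto simp: subset_iff image_iff)

lemma ex_tracks_one:
  assumes "p \<in> topspace M" "z \<in> index \<S>" "p \<in> Uset \<S> z"
  shows "\<exists>c. tracks c p \<and> fst c = \<one> \<and> fst (snd c 0) = z"
  using ex_tracks[of p \<one> z] assms image_one[OF Uset_subset] by simp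

lemma ex_coding_of_one:
  assumes "p \<in> topspace M"
  shows "\<exists>c. coding_of \<Gamma> \<G> \<rho> c p \<and> fst c = \<one>"
  using Uset_cover[OF assms] ex_tracks_one[OF assms] tracks_coding_of by blast

lemma coded_set_subset_Wset:
  assumes "coding \<Gamma> \<G> c" "fst c = \<one>"
  shows "coded_set \<Gamma> \<G> \<rho> c \<subseteq> Wset \<S> (fst (snd c 0))"
proof -
  have "coded_set \<Gamma> \<G> \<rho> c \<subseteq> cell \<Gamma> \<G> \<rho> c 0"
    using coded_set_eq[OF assms(1)] by blast
  also have "\<dots> = Wset \<S> (fst (snd c 0))"
    using image_one[OF vlabel_subset[OF tail_in_verts[OF codingD(2)[OF assms(1)]]], of 0] assms(2)
    by (simp add: cell_def generated_coder_simps)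
  finally show ?thesis .
qed

text \<open>A vertex with an outgoing edge has a nonempty \<open>Uset\<close> by the definition of
  edges, hence a nonempty label. Vertices without outgoing edges occur in no cell.\<close>

lemma generated_coded_set_nonempty:
  assumes "coding \<Gamma> \<G> c"
  shows "coded_set \<Gamma> \<G> \<rho> c \<noteq> {}"
proof (rule coded_set_nonempty[OF assms])
  fix v assume "v \<in> tail \<G> ` arcs \<G>"
  then show "vlabel \<G> v \<noteq> {}"
    using Uset_subset_Wset by (fastforce simp: generated_coder_def preimage_def)
qed

text \<open>An edge is the pair of its endpoints, so composability recovers the edges before
  \<open>n\<close> from the tails up to \<open>n\<close>. Of edge \<open>n\<close> itself the cell
  sees only the tail.\<close>

lemma cell_prefix_cong:
  assumes c: "coding \<Gamma> \<G> c" and d: "coding \<Gamma> \<G> d" and "fst c = fst d"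
    and eq: "\<And>i. i \<le> n \<Longrightarrow> fst (snd c i) = fst (snd d i)"
  shows "cell \<Gamma> \<G> \<sigma> c n = cell \<Gamma> \<G> \<sigma> d n"
proof -
  have "snd c i = snd d i" if "i < n" for i
    using that eq[of i] eq[of "Suc i"] codingD(3)[OF c, of i] codingD(3)[OF d, of i]
    by (simp add: generated_coder_simps prod_eq_iff)
  then have "path_seq \<Gamma> \<G> c n = path_seq \<Gamma> \<G> d n"
    by (rule path_seq_cong[OF assms(3)])
  then show ?thesis
    using eq[of n] by (simp add: cell_def generated_coder_simps)
qed

text \<open>Tracking up to stage \<open>n\<close> imposes finitely many open conditions on the
  point. Every point satisfying them has a greedy coding with the same first vertices, whatever its
  continuation.\<close>

lemma ex_open_tracks_prefix:
  assumes "tracks c p"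
  shows "\<exists>O'. openin M O' \<and> p \<in> O' \<and>
    (\<forall>p'\<in>O'. \<exists>c'. tracks c' p' \<and> fst c' = fst c \<and> (\<forall>i\<le>n. fst (snd c' i) = fst (snd c i)))"
proof -
  have c: "coding \<Gamma> \<G> c" and t: "\<And>i. p \<in> \<rho> (path_seq \<Gamma> \<G> c i) ` Uset \<S> (fst (snd c i))"
    using assms by (auto simp: tracks_def)
  have g: "path_seq \<Gamma> \<G> c i \<in> carrier \<Gamma>" for i
    by (rule path_seq_closed[OF codingD(1,2)[OF c]])
  have z: "fst (snd c i) \<in> index \<S>" for i
    using arc_index[OF codingD(2)[OF c]] by blast
  let ?O = "\<Inter>i\<in>{..n}. \<rho> (path_seq \<Gamma> \<G> c i) ` Uset \<S> (fst (snd c i))"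
  have O: "openin M ?O"
    using g z openin_Uset openin_image_action by (intro openin_INT2) auto
  moreover have "p \<in> ?O" using t by blast
  moreover have "\<exists>c'. tracks c' p' \<and> fst c' = fst c \<and> (\<forall>i\<le>n. fst (snd c' i) = fst (snd c i))"
    if p': "p' \<in> ?O" for p'
  proof -
    have "p' \<in> topspace M"
      using p' openin_subset[OF O] by blast
    then show ?thesis
      using ex_tracks_extending[of p' n "path_seq \<Gamma> \<G> c" "\<lambda>i. fst (snd c i)"] p' g z
      by (auto simp: generated_coder_simps)
  qed
  ultimately show ?thesis by blast
qed

end

text \<open>Stability turns each missing edge into disjointness of compact closures, which is an
  open condition on the action. Nearby actions therefore create no edge outside the original
  graph.\<close>

lemma eventually_proto_coder_action:
  assumes "proto_coder_action \<Gamma> M \<rho> \<rho> \<S>" "stable M \<rho> \<S>"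
  shows "\<forall>\<^sub>F \<sigma> in nhdsin (action_topology \<Gamma> M) \<rho>. proto_coder_action \<Gamma> M \<sigma> \<rho> \<S>"
proof -
  interpret proto_coder_action \<Gamma> M \<rho> \<rho> \<S> by (rule assms(1))
  define Q where "Q = index \<S> \<times> index \<S> - arcs \<G>"
  have "finite Q"
    using proto_coder by (simp add: Q_def is_proto_coder_def)
  moreover have "\<forall>\<^sub>F \<sigma> in nhdsin (action_topology \<Gamma> M) \<rho>.
      \<sigma> (label \<S> (fst x)) ` (M closure_of Uset \<S> (snd x)) \<subseteq> topspace M - M closure_of Uset \<S> (fst x)"
    if x: "x \<in> Q" for x
  proof (rule eventually_image_subset[OF _ compactin_closure])
    show l: "label \<S> (fst x) \<in> carrier \<Gamma>"
      using x label_closed by (auto simp: Q_def)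
    show "openin M (topspace M - M closure_of Uset \<S> (fst x))"
      by (intro openin_diff) auto
    have "preimage M (\<rho> (label \<S> (fst x))) (M closure_of (Uset \<S> (fst x))) \<inter>
        M closure_of (Uset \<S> (snd x)) = {}"
      using x assms by (auto simp: Q_def stable_def generated_coder_def)
    then show "\<rho> (label \<S> (fst x)) ` (M closure_of Uset \<S> (snd x))
        \<subseteq> topspace M - M closure_of Uset \<S> (fst x)"
      using closure_of_subset_topspace[of M] action_closed[OF l] by (fastforce simp: preimage_def)
  qed
  ultimately have "\<forall>\<^sub>F \<sigma> in nhdsin (action_topology \<Gamma> M) \<rho>. \<forall>x\<in>Q.
      \<sigma> (label \<S> (fst x)) ` (M closure_of Uset \<S> (snd x)) \<subseteq> topspace M - M closure_of Uset \<S> (fst x)"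
    by (intro eventually_ball_finite ballI)
  then show ?thesis
    using eventually_coder_action
  proof eventually_elim
    fix \<sigma>
    assume Q: "\<forall>x\<in>Q. \<sigma> (label \<S> (fst x)) ` (M closure_of Uset \<S> (snd x))
        \<subseteq> topspace M - M closure_of Uset \<S> (fst x)"
      and "coder_action \<Gamma> M \<sigma> \<G>"
    then interpret \<sigma>: coder_action \<Gamma> M \<sigma> \<G> by simp
    show "proto_coder_action \<Gamma> M \<sigma> \<rho> \<S>"
    proof
      fix z y x
      assume *: "z \<in> index \<S>" "y \<in> index \<S>" "x \<in> Uset \<S> y" "\<sigma> (label \<S> z) x \<in> Uset \<S> z"
      have "x \<in> M closure_of Uset \<S> y" "\<sigma> (label \<S> z) x \<in> M closure_of Uset \<S> z"
        using * closure_of_subset[OF Uset_subset] by blast+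
      then have "(z, y) \<notin> Q"
        using Q by force
      then show "(z, y) \<in> arcs \<G>"
        using *(1,2) by (simp add: Q_def)
    qed (rule proto_coder)
  qed
qed

text \<open>Of (P4) only the consequence \<open>coded_set_unique\<close> is kept: the coded set for
  \<open>\<rho>\<close> depends on the point coded for \<open>\<rho>\<^sub>0\<close>, not on the
  chosen coding.\<close>

locale coder_perturbation =
  old: proto_coder_action \<Gamma> M \<rho>\<^sub>0 \<rho>\<^sub>0 \<S> + new: proto_coder_action \<Gamma> M \<rho> \<rho>\<^sub>0 \<S>
  for \<Gamma> :: "('g, 'b) monoid_scheme" (structure) and M :: "'m topology"
    and \<rho> \<rho>\<^sub>0 and \<S> :: "('z, 'g, 'm) proto_coder" +
  fixes S :: "'g set"
  assumes generators: "S \<subseteq> carrier \<Gamma>" "generate \<Gamma> S = carrier \<Gamma>"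
    and contracting: "contracting \<Gamma> (generated_coder M \<S> \<rho>\<^sub>0) \<rho>\<^sub>0"
    and separating: "\<And>p p'. p \<in> topspace M \<Longrightarrow> p' \<in> topspace M \<Longrightarrow> p \<noteq> p' \<Longrightarrow>
      \<exists>\<gamma>\<in>carrier \<Gamma>. \<forall>z\<in>index \<S>. \<forall>z'\<in>index \<S>.
        \<rho>\<^sub>0 \<gamma> p \<in> Uset \<S> z \<and> \<rho>\<^sub>0 \<gamma> p' \<in> Uset \<S> z' \<longrightarrow> Wset \<S> z \<inter> Wset \<S> z' = {}"
    and coded_set_unique: "\<And>c d q. coding_of \<Gamma> (generated_coder M \<S> \<rho>\<^sub>0) \<rho>\<^sub>0 c q \<Longrightarrow>
      coding_of \<Gamma> (generated_coder M \<S> \<rho>\<^sub>0) \<rho>\<^sub>0 d q \<Longrightarrow>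
      fst c \<in> S \<union> {\<one>} \<Longrightarrow> fst d \<in> S \<union> {\<one>} \<Longrightarrow>
      coded_set \<Gamma> (generated_coder M \<S> \<rho>\<^sub>0) \<rho> c = coded_set \<Gamma> (generated_coder M \<S> \<rho>\<^sub>0) \<rho> d"
begin

section \<open>The fibre relation and its equivariance\<close>

abbreviation "\<G> \<equiv> generated_coder M \<S> \<rho>\<^sub>0"

text \<open>The relation \<open>related p q\<close> is the graph of the semiconjugacy: \<open>p\<close> lies in the fibre over \<open>q\<close>.\<close>

definition related :: "'m \<Rightarrow> 'm \<Rightarrow> bool" where
  "related p q \<longleftrightarrow> (\<exists>c. coding_of \<Gamma> \<G> \<rho>\<^sub>0 c q \<and> fst c = \<one> \<and> p \<in> coded_set \<Gamma> \<G> \<rho> c)"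

lemma related_topspace: "related p q \<Longrightarrow> p \<in> topspace M \<and> q \<in> topspace M"
  using old.coded_set_subset new.coded_set_subset unfolding related_def coding_of_def by blast

lemma relatedD:
  assumes "related p q" "coding_of \<Gamma> \<G> \<rho>\<^sub>0 c q" "fst c \<in> S \<union> {\<one>}"
  shows "p \<in> coded_set \<Gamma> \<G> \<rho> c"
  using assms coded_set_unique unfolding related_def by blast

text \<open>Being a coding is a property of the graph alone, and contraction for
  \<open>\<rho>\<^sub>0\<close> makes every coding code a point for
  \<open>\<rho>\<^sub>0\<close>.\<close>

lemma coding_of_common:
  assumes "coding_of \<Gamma> \<G> \<rho> c p"
  shows "\<exists>q. coding_of \<Gamma> \<G> \<rho>\<^sub>0 c q"
  using assms contracting unfolding coding_of_def contracting_def by blast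

lemma related_left_total:
  assumes "p \<in> topspace M"
  shows "\<exists>q. related p q"
  using new.ex_coding_of_one[OF assms] coding_of_common unfolding related_def coding_of_def by blast

lemma related_right_total:
  assumes "q \<in> topspace M"
  shows "\<exists>p. related p q"
  using old.ex_coding_of_one[OF assms] new.generated_coded_set_nonempty
  unfolding related_def coding_of_def by blast

lemma coding_of_translate:
  assumes "coding_of \<Gamma> \<G> \<rho>\<^sub>0 c q" "s \<in> carrier \<Gamma>"
  shows "coding_of \<Gamma> \<G> \<rho>\<^sub>0 (s \<otimes> fst c, snd c) (\<rho>\<^sub>0 s q)"
  using assms old.coding_translate old.coded_set_translate unfolding coding_of_def by blast

text \<open>Translating a coding of \<open>q\<close> by \<open>s\<close> gives a coding of
  \<open>\<rho>\<^sub>0 s q\<close> with initial point in \<open>S\<close>. It has the same coded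
  set for \<open>\<rho>\<close> as a coding of that point starting at \<open>\<one>\<close>.\<close>

lemma related_generator:
  assumes s: "s \<in> S" and rel: "related p q"
  shows "related (\<rho> s p) (\<rho>\<^sub>0 s q)"
proof -
  have sc: "s \<in> carrier \<Gamma>" using s generators by blast
  have "\<rho>\<^sub>0 s q \<in> topspace M"
    using related_topspace[OF rel] old.action_closed[OF sc] by blast
  then obtain d where d: "coding_of \<Gamma> \<G> \<rho>\<^sub>0 d (\<rho>\<^sub>0 s q)" "fst d = \<one>"
    using old.ex_coding_of_one by blast
  obtain c where c: "coding_of \<Gamma> \<G> \<rho>\<^sub>0 c q" "fst c = \<one>" "p \<in> coded_set \<Gamma> \<G> \<rho> c"
    using rel unfolding related_def by blast
  have "coded_set \<Gamma> \<G> \<rho> d = coded_set \<Gamma> \<G> \<rho> (s \<otimes> fst c, snd c)"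
    using coded_set_unique[OF d(1) coding_of_translate[OF c(1) sc]] d(2) c(2) s sc by simp
  also have "\<dots> = \<rho> s ` coded_set \<Gamma> \<G> \<rho> c"
    using new.coded_set_translate sc c(1) unfolding coding_of_def by blast
  finally show ?thesis
    using d c(3) unfolding related_def by blast
qed

text \<open>\<open>S\<close> need not be closed under inverses. Therefore a coding of the point
  \<open>\<rho>\<^sub>0 (inv s) q\<close> is translated forward by \<open>s\<close>, which again
  gives an initial point in \<open>S\<close>.\<close>

lemma related_inv_generator:
  assumes s: "s \<in> S" and rel: "related p q"
  shows "related (\<rho> (inv s) p) (\<rho>\<^sub>0 (inv s) q)"
proof -
  have sc: "s \<in> carrier \<Gamma>" using s generators by blast
  have pq: "p \<in> topspace M" "q \<in> topspace M"
    using related_topspace[OF rel] by auto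
  then obtain c where c: "coding_of \<Gamma> \<G> \<rho>\<^sub>0 c (\<rho>\<^sub>0 (inv s) q)" "fst c = \<one>"
    using old.ex_coding_of_one old.action_closed[OF old.inv_closed[OF sc]] by blast
  have "coding_of \<Gamma> \<G> \<rho>\<^sub>0 (s \<otimes> fst c, snd c) q"
    using coding_of_translate[OF c(1) sc] old.action_inv(2)[OF sc pq(2)] by simp
  then have "p \<in> coded_set \<Gamma> \<G> \<rho> (s \<otimes> fst c, snd c)"
    using relatedD[OF rel] c(2) s sc by simp
  also have "\<dots> = \<rho> s ` coded_set \<Gamma> \<G> \<rho> c"
    using new.coded_set_translate sc c(1) unfolding coding_of_def by blast
  finally have "\<rho> (inv s) p \<in> coded_set \<Gamma> \<G> \<rho> c"
    using new.mem_image_action_iff[OF sc new.coded_set_subset pq(1)] c(1)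
    unfolding coding_of_def by blast
  then show ?thesis
    using c unfolding related_def by blast
qed

lemma related_action:
  assumes "\<gamma> \<in> carrier \<Gamma>" "related p q"
  shows "related (\<rho> \<gamma> p) (\<rho>\<^sub>0 \<gamma> q)"
proof -
  have "\<gamma> \<in> generate \<Gamma> S" using assms(1) generators by simp
  then show ?thesis using assms(2)
  proof (induction arbitrary: p q rule: generate.induct)
    case one
    then show ?case
      using related_topspace old.action_one new.action_one by simp
  next
    case (incl h)
    then show ?case by (rule related_generator)
  next
    case (inv h)
    then show ?case by (rule related_inv_generator)
  next
    case (eng h1 h2)
    then show ?case
      using related_topspace[OF eng.prems] generators(2) old.action_mult[of h1 h2 q]
        new.action_mult[of h1 h2 p] by simp
  qed
qed

text \<open>Equivariance moves two distinct candidates to the separated position given by (P3),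
  where the image of \<open>p\<close> would lie in two disjoint sets \<open>Wset\<close>.\<close>

lemma related_unique:
  assumes "related p q" "related p q'"
  shows "q = q'"
proof (rule ccontr)
  assume "q \<noteq> q'"
  have pq: "p \<in> topspace M" "q \<in> topspace M" "q' \<in> topspace M"
    using related_topspace assms by auto
  obtain \<gamma> where \<gamma>: "\<gamma> \<in> carrier \<Gamma>" and
    sep: "\<And>z z'. z \<in> index \<S> \<Longrightarrow> z' \<in> index \<S> \<Longrightarrow> \<rho>\<^sub>0 \<gamma> q \<in> Uset \<S> z \<Longrightarrow> \<rho>\<^sub>0 \<gamma> q' \<in> Uset \<S> z' \<Longrightarrow>
      Wset \<S> z \<inter> Wset \<S> z' = {}"
    using separating[OF pq(2,3) \<open>q \<noteq> q'\<close>] by blast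
  \<comment> \<open>The coding of \<open>r\<close> may start at any vertex \<open>z\<close> whose
    \<open>Uset\<close> contains \<open>r\<close>, and \<open>relatedD\<close> transfers membership
    to it. With initial point \<open>\<one>\<close> its coded set lies in the \<open>Wset\<close> of
    \<open>z\<close>.\<close>
  have "\<exists>z\<in>index \<S>. r \<in> Uset \<S> z \<and> \<rho> \<gamma> p \<in> Wset \<S> z" if "related (\<rho> \<gamma> p) r" for r
  proof -
    have r: "r \<in> topspace M" using related_topspace[OF that] by blast
    obtain z where z: "z \<in> index \<S>" "r \<in> Uset \<S> z" using old.Uset_cover[OF r] by blast
    obtain c where c: "old.tracks c r" "fst c = \<one>" "fst (snd c 0) = z"
      using old.ex_tracks_one[OF r z] by blast
    have "coding_of \<Gamma> \<G> \<rho>\<^sub>0 c r" by (rule old.tracks_coding_of[OF c(1)])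
    then have "\<rho> \<gamma> p \<in> Wset \<S> z"
      using relatedD[OF that, of c] new.coded_set_subset_Wset[of c] c unfolding coding_of_def by blast
    then show ?thesis using z by blast
  qed
  then show False
    using related_action[OF \<gamma>] assms sep by (metis disjoint_iff)
qed

section \<open>The semiconjugacy and its continuity\<close>

definition semiconjugacy :: "'m \<Rightarrow> 'm" where
  "semiconjugacy p = (THE q. related p q)"

lemma semiconjugacy_eqI: "related p q \<Longrightarrow> semiconjugacy p = q"
  unfolding semiconjugacy_def using related_unique by blast

lemma related_semiconjugacy: "p \<in> topspace M \<Longrightarrow> related p (semiconjugacy p)"
  using related_left_total semiconjugacy_eqI by blast

lemma semiconjugacy_surj: "semiconjugacy ` topspace M = topspace M"
proof
  show "semiconjugacy ` topspace M \<subseteq> topspace M"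
    using related_semiconjugacy related_topspace by blast
  show "topspace M \<subseteq> semiconjugacy ` topspace M"
  proof
    fix q assume "q \<in> topspace M"
    then obtain p where "related p q" using related_right_total by blast
    then show "q \<in> semiconjugacy ` topspace M"
      using semiconjugacy_eqI related_topspace by blast
  qed
qed

lemma semiconjugacy_equivariant:
  assumes "\<gamma> \<in> carrier \<Gamma>" "p \<in> topspace M"
  shows "semiconjugacy (\<rho> \<gamma> p) = \<rho>\<^sub>0 \<gamma> (semiconjugacy p)"
  using assms related_action related_semiconjugacy semiconjugacy_eqI by blast

text \<open>The image of \<open>p\<close> is computed by reading a greedy
  \<open>\<rho>\<close>-coding of \<open>p\<close> under \<open>\<rho>\<^sub>0\<close>. Such codings
  vary controllably with \<open>p\<close>, which is what continuity uses.\<close>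

lemma tracks_semiconjugacy:
  assumes "new.tracks c p" "fst c = \<one>"
  shows "coded_set \<Gamma> \<G> \<rho>\<^sub>0 c = {semiconjugacy p}"
proof -
  have c: "coding_of \<Gamma> \<G> \<rho> c p" by (rule new.tracks_coding_of[OF assms(1)])
  then obtain q where q: "coded_set \<Gamma> \<G> \<rho>\<^sub>0 c = {q}"
    using contracting unfolding coding_of_def contracting_def by blast
  then have "related p q"
    using c assms(2) unfolding related_def coding_of_def by blast
  then show ?thesis using q semiconjugacy_eqI by blast
qed

text \<open>By contraction some \<open>\<rho>\<^sub>0\<close>-cell of a greedy coding of
  \<open>p\<close> lies in \<open>V\<close>. Points near \<open>p\<close> have greedy codings with
  the same prefix, so their images lie in the same cell.\<close>

lemma continuous_map_semiconjugacy: "continuous_map M M semiconjugacy"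
  unfolding continuous_map_eq_topcontinuous_at topcontinuous_at_def
proof (intro ballI conjI allI impI)
  fix p assume p: "p \<in> topspace M"
  then show "p \<in> topspace M" .
  show "semiconjugacy \<in> topspace M \<rightarrow> topspace M" using semiconjugacy_surj by blast
  fix V assume V: "openin M V \<and> semiconjugacy p \<in> V"
  obtain z where "z \<in> index \<S>" "p \<in> Uset \<S> z" using new.Uset_cover[OF p] by blast
  then obtain c where c: "new.tracks c p" "fst c = \<one>"
    using new.ex_tracks_one[OF p] by blast
  then have cc: "coding \<Gamma> \<G> c" by (simp add: new.tracks_def)
  obtain n where n: "cell \<Gamma> \<G> \<rho>\<^sub>0 c n \<subseteq> V"
    using old.cell_eventually_subset[OF cc, of V] V tracks_semiconjugacy[OF c] by auto
  obtain O' where O': "openin M O'" "p \<in> O'"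
    "\<And>p'. p' \<in> O' \<Longrightarrow> \<exists>c'. new.tracks c' p' \<and> fst c' = fst c \<and> (\<forall>i\<le>n. fst (snd c' i) = fst (snd c i))"
    using new.ex_open_tracks_prefix[OF c(1), of n] by blast
  have "semiconjugacy p' \<in> V" if "p' \<in> O'" for p'
  proof -
    obtain c' where c': "new.tracks c' p'" "fst c' = fst c" "\<forall>i\<le>n. fst (snd c' i) = fst (snd c i)"
      using O'(3) \<open>p' \<in> O'\<close> by blast
    then have cc': "coding \<Gamma> \<G> c'" by (simp add: new.tracks_def)
    have "semiconjugacy p' \<in> cell \<Gamma> \<G> \<rho>\<^sub>0 c' n"
      using tracks_semiconjugacy[OF c'(1)] c'(2) c(2) old.coded_set_eq[OF cc'] by auto
    also have "\<dots> = cell \<Gamma> \<G> \<rho>\<^sub>0 c n"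
      using c' by (intro old.cell_prefix_cong[OF cc' cc]) auto
    finally show ?thesis using n by blast
  qed
  then show "\<exists>U. openin M U \<and> p \<in> U \<and> (\<forall>y\<in>U. semiconjugacy y \<in> V)"
    using O' by blast
qed

end

text \<open>(P4) measures closeness from the auxiliary coding to the given ones. Equality of coded
  sets needs inclusions both ways, hence also the reverse comparison with the inverted finite
  set.\<close>

lemma F_close_sym:
  fixes \<Gamma> (structure)
  assumes "group \<Gamma>" "\<And>n. g n \<in> carrier \<Gamma>" "\<And>n. h n \<in> carrier \<Gamma>" "F_close \<Gamma> F g h"
  shows "F_close \<Gamma> ((\<lambda>f. inv f) ` F) h g"
proof -
  interpret group \<Gamma> by (rule assms(1))
  have "inv (inv (g n) \<otimes> h m) = inv (h m) \<otimes> g n" for n m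
    using assms(2,3) by (simp add: inv_mult_group)
  then show ?thesis
    using assms(4) unfolding F_close_def by (metis imageI)
qed

theorem theorem2p12:
  fixes \<Gamma> :: "('g, 'b) monoid_scheme"
    and M :: "'m topology"
    and S :: "'g set"
    and \<rho>\<^sub>0 :: "'g \<Rightarrow> 'm \<Rightarrow> 'm"
    and \<S> :: "('z, 'g, 'm) proto_coder"
    and \<S>' :: "('y, 'g, 'm) proto_coder"
  defines "\<G> \<equiv> generated_coder M \<S> \<rho>\<^sub>0"
    and "\<G>' \<equiv> generated_coder M \<S>' \<rho>\<^sub>0"
  assumes "compact_space M" and "metrizable_space M"
    and "group \<Gamma>"
    and "S \<subseteq> carrier \<Gamma>" and "finite S" and "generate \<Gamma> S = carrier \<Gamma>"
    and "\<rho>\<^sub>0 \<in> actions \<Gamma> M"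
    and "is_proto_coder \<Gamma> M \<S>" and "adapted M \<rho>\<^sub>0 \<S>"
    and "is_proto_coder \<Gamma> M \<S>'" and "adapted M \<rho>\<^sub>0 \<S>'"
    and P1: "stable M \<rho>\<^sub>0 \<S>" "stable M \<rho>\<^sub>0 \<S>'"
    and P2: "contracting \<Gamma> \<G> \<rho>\<^sub>0" "contracting \<Gamma> \<G>' \<rho>\<^sub>0"
    and P3: "\<forall>p\<in>topspace M. \<forall>p'\<in>topspace M. p \<noteq> p' \<longrightarrow>
      (\<exists>\<gamma>\<in>carrier \<Gamma>. \<forall>z\<in>index \<S>. \<forall>z'\<in>index \<S>.
        \<rho>\<^sub>0 \<gamma> p \<in> Uset \<S> z \<and> \<rho>\<^sub>0 \<gamma> p' \<in> Uset \<S> z' \<longrightarrow> Wset \<S> z \<inter> Wset \<S> z' = {})"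
    and P4: "\<exists>F\<subseteq>carrier \<Gamma>. finite F \<and>
      (\<forall>p\<in>topspace M. \<forall>c\<^sub>1 c\<^sub>2.
        coding_of \<Gamma> \<G> \<rho>\<^sub>0 c\<^sub>1 p \<and> coding_of \<Gamma> \<G> \<rho>\<^sub>0 c\<^sub>2 p \<and>
        fst c\<^sub>1 \<in> S \<union> {\<one>\<^bsub>\<Gamma>\<^esub>} \<and> fst c\<^sub>2 \<in> S \<union> {\<one>\<^bsub>\<Gamma>\<^esub>} \<longrightarrow>
        (\<exists>c. coding_of \<Gamma> \<G>' \<rho>\<^sub>0 c p \<and> fst c = \<one>\<^bsub>\<Gamma>\<^esub> \<and>
          F_close \<Gamma> F (path_seq \<Gamma> \<G>' c) (path_seq \<Gamma> \<G> c\<^sub>1) \<and>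
          F_close \<Gamma> F (path_seq \<Gamma> \<G>' c) (path_seq \<Gamma> \<G> c\<^sub>2)))"
  shows "topologically_stable \<Gamma> M \<rho>\<^sub>0"
proof -
  obtain F where F: "F \<subseteq> carrier \<Gamma>" "finite F" and
    close: "\<forall>p\<in>topspace M. \<forall>c\<^sub>1 c\<^sub>2.
      coding_of \<Gamma> \<G> \<rho>\<^sub>0 c\<^sub>1 p \<and> coding_of \<Gamma> \<G> \<rho>\<^sub>0 c\<^sub>2 p \<and>
      fst c\<^sub>1 \<in> S \<union> {\<one>\<^bsub>\<Gamma>\<^esub>} \<and> fst c\<^sub>2 \<in> S \<union> {\<one>\<^bsub>\<Gamma>\<^esub>} \<longrightarrow>
      (\<exists>c. coding_of \<Gamma> \<G>' \<rho>\<^sub>0 c p \<and> fst c = \<one>\<^bsub>\<Gamma>\<^esub> \<and>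
        F_close \<Gamma> F (path_seq \<Gamma> \<G>' c) (path_seq \<Gamma> \<G> c\<^sub>1) \<and>
        F_close \<Gamma> F (path_seq \<Gamma> \<G>' c) (path_seq \<Gamma> \<G> c\<^sub>2))"
    using P4 by (elim exE conjE) (rule that)
  interpret group \<Gamma> by fact
  have ha: "homeo_action \<Gamma> M \<rho>\<^sub>0"
    by unfold_locales fact
  interpret G: coder_action \<Gamma> M \<rho>\<^sub>0 \<G>
    unfolding \<G>_def using ha assms is_point_coder_generated_coder
    by (auto simp: coder_action_def coder_action_axioms_def)
  interpret G': coder_action \<Gamma> M \<rho>\<^sub>0 \<G>'
    unfolding \<G>'_def using ha assms is_point_coder_generated_coder
    by (auto simp: coder_action_def coder_action_axioms_def)
  interpret old: proto_coder_action \<Gamma> M \<rho>\<^sub>0 \<rho>\<^sub>0 \<S>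
  proof (intro proto_coder_action.intro proto_coder_action_axioms.intro)
    show "coder_action \<Gamma> M \<rho>\<^sub>0 (generated_coder M \<S> \<rho>\<^sub>0)"
      using G.coder_action_axioms by (simp add: \<G>_def)
    show "is_proto_coder \<Gamma> M \<S>" by fact
    fix z y x
    assume *: "z \<in> index \<S>" "y \<in> index \<S>" "x \<in> Uset \<S> y" "\<rho>\<^sub>0 (label \<S> z) x \<in> Uset \<S> z"
    moreover have "x \<in> topspace M"
      using * \<open>is_proto_coder \<Gamma> M \<S>\<close> openin_subset by (fastforce simp: is_proto_coder_def)
    ultimately show "(z, y) \<in> arcs (generated_coder M \<S> \<rho>\<^sub>0)"
      by (auto simp: generated_coder_def preimage_def)
  qed
  let ?F' = "(\<lambda>f. inv\<^bsub>\<Gamma>\<^esub> f) ` F"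
  have F': "finite ?F'" "?F' \<subseteq> carrier \<Gamma>"
    using F by auto
  have "\<forall>\<^sub>F \<rho> in nhdsin (action_topology \<Gamma> M) \<rho>\<^sub>0. coder_perturbation \<Gamma> M \<rho> \<rho>\<^sub>0 \<S> S"
    using G.eventually_coded_set_subset[OF P2(1) G'.coder_action_axioms F']
      G'.eventually_coded_set_subset[OF P2(2) G.coder_action_axioms F(2,1)]
      eventually_proto_coder_action[OF old.proto_coder_action_axioms P1(1)]
  proof eventually_elim
    fix \<rho>
    assume sub: "\<forall>q c d. coding_of \<Gamma> \<G> \<rho>\<^sub>0 c q \<and> coding_of \<Gamma> \<G>' \<rho>\<^sub>0 d q \<and>
        F_close \<Gamma> ?F' (path_seq \<Gamma> \<G> c) (path_seq \<Gamma> \<G>' d) \<longrightarrow>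
        coded_set \<Gamma> \<G> \<rho> c \<subseteq> coded_set \<Gamma> \<G>' \<rho> d"
      and sub': "\<forall>q c d. coding_of \<Gamma> \<G>' \<rho>\<^sub>0 c q \<and> coding_of \<Gamma> \<G> \<rho>\<^sub>0 d q \<and>
        F_close \<Gamma> F (path_seq \<Gamma> \<G>' c) (path_seq \<Gamma> \<G> d) \<longrightarrow>
        coded_set \<Gamma> \<G>' \<rho> c \<subseteq> coded_set \<Gamma> \<G> \<rho> d"
      and new: "proto_coder_action \<Gamma> M \<rho> \<rho>\<^sub>0 \<S>"
    have eq: "coded_set \<Gamma> \<G> \<rho> c = coded_set \<Gamma> \<G>' \<rho> d"
      if c: "coding_of \<Gamma> \<G> \<rho>\<^sub>0 c q" and d: "coding_of \<Gamma> \<G>' \<rho>\<^sub>0 d q"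
        and cl: "F_close \<Gamma> F (path_seq \<Gamma> \<G>' d) (path_seq \<Gamma> \<G> c)" for c d q
    proof
      have cc: "coding \<Gamma> \<G> c" and dd: "coding \<Gamma> \<G>' d"
        using c d by (auto simp: coding_of_def)
      show "coded_set \<Gamma> \<G>' \<rho> d \<subseteq> coded_set \<Gamma> \<G> \<rho> c"
        using sub' c d cl by blast
      have "F_close \<Gamma> ?F' (path_seq \<Gamma> \<G> c) (path_seq \<Gamma> \<G>' d)"
        by (rule F_close_sym[OF is_group G'.path_seq_closed[OF G'.codingD(1,2)[OF dd]]
              G.path_seq_closed[OF G.codingD(1,2)[OF cc]] cl])
      then show "coded_set \<Gamma> \<G> \<rho> c \<subseteq> coded_set \<Gamma> \<G>' \<rho> d"
        using sub c d by blast
    qed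
    interpret new: proto_coder_action \<Gamma> M \<rho> \<rho>\<^sub>0 \<S> by (rule new)
    show "coder_perturbation \<Gamma> M \<rho> \<rho>\<^sub>0 \<S> S"
    proof
      show "S \<subseteq> carrier \<Gamma>" "generate \<Gamma> S = carrier \<Gamma>"
        "contracting \<Gamma> (generated_coder M \<S> \<rho>\<^sub>0) \<rho>\<^sub>0"
        using assms by (auto simp: \<G>_def)
      show "\<exists>\<gamma>\<in>carrier \<Gamma>. \<forall>z\<in>index \<S>. \<forall>z'\<in>index \<S>.
          \<rho>\<^sub>0 \<gamma> p \<in> Uset \<S> z \<and> \<rho>\<^sub>0 \<gamma> p' \<in> Uset \<S> z' \<longrightarrow> Wset \<S> z \<inter> Wset \<S> z' = {}"
        if "p \<in> topspace M" "p' \<in> topspace M" "p \<noteq> p'" for p p'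
        using P3 that by blast
      fix c d q
      assume *: "coding_of \<Gamma> (generated_coder M \<S> \<rho>\<^sub>0) \<rho>\<^sub>0 c q"
        "coding_of \<Gamma> (generated_coder M \<S> \<rho>\<^sub>0) \<rho>\<^sub>0 d q"
        "fst c \<in> S \<union> {\<one>\<^bsub>\<Gamma>\<^esub>}" "fst d \<in> S \<union> {\<one>\<^bsub>\<Gamma>\<^esub>}"
      then have cd: "coding_of \<Gamma> \<G> \<rho>\<^sub>0 c q" "coding_of \<Gamma> \<G> \<rho>\<^sub>0 d q"
        by (simp_all add: \<G>_def)
      then have "q \<in> topspace M"
        using G.coded_set_subset unfolding coding_of_def by blast
      \<comment> \<open>The coding \<open>b\<close> of the second coder is the intermediary: its
        coded set for \<open>\<rho>\<close> equals those of both \<open>c\<close> and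
        \<open>d\<close>.\<close>
      then obtain b where "coding_of \<Gamma> \<G>' \<rho>\<^sub>0 b q"
        "F_close \<Gamma> F (path_seq \<Gamma> \<G>' b) (path_seq \<Gamma> \<G> c)"
        "F_close \<Gamma> F (path_seq \<Gamma> \<G>' b) (path_seq \<Gamma> \<G> d)"
        using close cd *(3,4) by blast
      then show "coded_set \<Gamma> (generated_coder M \<S> \<rho>\<^sub>0) \<rho> c = coded_set \<Gamma> (generated_coder M \<S> \<rho>\<^sub>0) \<rho> d"
        using eq cd by (metis \<G>_def)
    qed
  qed
  then obtain \<U> where \<U>: "openin (action_topology \<Gamma> M) \<U>" "\<rho>\<^sub>0 \<in> \<U>"
    and pert: "\<And>\<rho>. \<rho> \<in> \<U> \<Longrightarrow> coder_perturbation \<Gamma> M \<rho> \<rho>\<^sub>0 \<S> S"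
    using G.action unfolding eventually_nhdsin topspace_action_topology by blast
  show ?thesis
    unfolding topologically_stable_def
  proof (intro exI[of _ \<U>] conjI ballI \<U>)
    fix \<rho> assume "\<rho> \<in> \<U>"
    then interpret coder_perturbation \<Gamma> M \<rho> \<rho>\<^sub>0 \<S> S by (rule pert)
    show "\<exists>\<phi>. continuous_map M M \<phi> \<and> \<phi> ` topspace M = topspace M \<and>
        (\<forall>\<gamma>\<in>carrier \<Gamma>. \<forall>x\<in>topspace M. \<phi> (\<rho> \<gamma> x) = \<rho>\<^sub>0 \<gamma> (\<phi> x))"
      using continuous_map_semiconjugacy semiconjugacy_surj semiconjugacy_equivariant by blast
  qed
qed

end
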